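(* Let $P$ be a finite poset with labeling $\omega$ such that $P$ is $\omega$-consistent with rank function $\rho$, and suppose $|\rho(x)-\rho(y)|\le1$ for all maximal elements $x,y$ of $P$. Then $W(P,\omega;t)$ has unimodal coefficients.
   Context: $P$ has $p$ elements and $\omega:P\to\{1,\dots,p\}$ is a bijection. Write $x\prec y$ if $y$ covers $x$; $\omega$ induces $\epsilon(x,y)=1$ if $\omega(x)<\omega(y)$ and $-1$ otherwise on covering pairs. $P$ is $\omega$-consistent if for every $z\in P$ the sum $\sum\epsilon(x_{i-1},x_i)$ is the same over all maximal chains $x_0\prec\cdots\prec x_n$ of the principal ideal $\Lambda_z=\{w\le z\}$; this common value is $\rho(z)$. $W(P,\omega;t)=\sum_{\pi}t^{\mathrm{des}(\pi)}$, summing over permutations $\pi=\omega(x_1)\cdots\omega(x_p)$ with $x_1,\dots,x_p$ a linear extension of $P$, where $\mathrm{des}(\pi)=\#\{i:\pi_i>\pi_{i+1}\}$. *)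

theory Defs
  imports Main "HOL-Computational_Algebra.Polynomial"
begin

definition partial_order_on' :: "'a set \<Rightarrow> ('a \<Rightarrow> 'a \<Rightarrow> bool) \<Rightarrow> bool" where
  "partial_order_on' P le \<longleftrightarrow>
     (\<forall>x\<in>P. le x x) \<and>
     (\<forall>x\<in>P. \<forall>y\<in>P. le x y \<and> le y x \<longrightarrow> x = y) \<and>
     (\<forall>x\<in>P. \<forall>y\<in>P. \<forall>z\<in>P. le x y \<and> le y z \<longrightarrow> le x z)"

definition pless :: "('a \<Rightarrow> 'a \<Rightarrow> bool) \<Rightarrow> 'a \<Rightarrow> 'a \<Rightarrow> bool" where
  "pless le x y \<longleftrightarrow> le x y \<and> x \<noteq> y"

definition covers :: "'a set \<Rightarrow> ('a \<Rightarrow> 'a \<Rightarrow> bool) \<Rightarrow> 'a \<Rightarrow> 'a \<Rightarrow> bool" where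
  "covers P le x y \<longleftrightarrow> x \<in> P \<and> y \<in> P \<and> pless le x y \<and>
     \<not> (\<exists>z\<in>P. pless le x z \<and> pless le z y)"

definition labeling :: "'a set \<Rightarrow> ('a \<Rightarrow> nat) \<Rightarrow> bool" where
  "labeling P \<omega> \<longleftrightarrow> bij_betw \<omega> P {1..card P}"

definition eps :: "('a \<Rightarrow> nat) \<Rightarrow> 'a \<Rightarrow> 'a \<Rightarrow> int" where
  "eps \<omega> x y = (if \<omega> x < \<omega> y then 1 else -1)"

text \<open>Maximal chains x_0 < ... < x_n of the principal ideal {w. w \<le> z}:
  x_0 is minimal, consecutive elements are covering pairs, x_n = z.\<close>
definition max_chains_ideal :: "'a set \<Rightarrow> ('a \<Rightarrow> 'a \<Rightarrow> bool) \<Rightarrow> 'a \<Rightarrow> 'a list set" where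
  "max_chains_ideal P le z = {c. c \<noteq> [] \<and> last c = z \<and> hd c \<in> P \<and>
       \<not> (\<exists>w\<in>P. pless le w (hd c)) \<and>
       (\<forall>i. Suc i < length c \<longrightarrow> covers P le (c ! i) (c ! Suc i))}"

definition chain_eps_sum :: "('a \<Rightarrow> nat) \<Rightarrow> 'a list \<Rightarrow> int" where
  "chain_eps_sum \<omega> c = (\<Sum>i<length c - 1. eps \<omega> (c ! i) (c ! Suc i))"

definition omega_consistent_rank ::
  "'a set \<Rightarrow> ('a \<Rightarrow> 'a \<Rightarrow> bool) \<Rightarrow> ('a \<Rightarrow> nat) \<Rightarrow> ('a \<Rightarrow> int) \<Rightarrow> bool" where
  "omega_consistent_rank P le \<omega> \<rho> \<longleftrightarrow>
     (\<forall>z\<in>P. \<forall>c\<in>max_chains_ideal P le z. chain_eps_sum \<omega> c = \<rho> z)"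

definition maximal_elem :: "'a set \<Rightarrow> ('a \<Rightarrow> 'a \<Rightarrow> bool) \<Rightarrow> 'a \<Rightarrow> bool" where
  "maximal_elem P le x \<longleftrightarrow> x \<in> P \<and> \<not> (\<exists>y\<in>P. pless le x y)"

definition linear_extensions :: "'a set \<Rightarrow> ('a \<Rightarrow> 'a \<Rightarrow> bool) \<Rightarrow> 'a list set" where
  "linear_extensions P le = {xs. distinct xs \<and> set xs = P \<and>
       (\<forall>i<length xs. \<forall>j<length xs. le (xs ! i) (xs ! j) \<longrightarrow> i \<le> j)}"

definition des :: "nat list \<Rightarrow> nat" where
  "des \<pi> = card {i. Suc i < length \<pi> \<and> \<pi> ! i > \<pi> ! Suc i}"

definition W :: "'a set \<Rightarrow> ('a \<Rightarrow> 'a \<Rightarrow> bool) \<Rightarrow> ('a \<Rightarrow> nat) \<Rightarrow> nat poly" where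
  "W P le \<omega> = (\<Sum>xs\<in>linear_extensions P le. monom 1 (des (map \<omega> xs)))"

definition unimodal_seq :: "(nat \<Rightarrow> 'b::linorder) \<Rightarrow> bool" where
  "unimodal_seq a \<longleftrightarrow> (\<exists>m. (\<forall>i j. i \<le> j \<and> j \<le> m \<longrightarrow> a i \<le> a j) \<and>
                            (\<forall>i j. m \<le> i \<and> i \<le> j \<longrightarrow> a j \<le> a i))"

end

theory Submission
  imports
    Defs
    "HOL-Combinatorics.Multiset_Permutations"
    "HOL-Library.FuncSet"
    "HOL-Library.Product_Lexorder"
begin

text \<open>
  The number of labeled poset partitions with values in \<open>{0..n}\<close>, as a function of \<open>n\<close>, determines the
  descent polynomial. If \<open>\<sigma>\<close> is such a partition, then \<open>2 \<sigma> + \<rho>\<close> increases strictly along covers;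
  hence replacing \<open>\<rho>\<close> by \<open>\<rho> - 2 q\<close> and \<open>\<sigma>\<close> by \<open>\<sigma> + q\<close> preserves the partition conditions. If \<open>q\<close>
  vanishes on minimal elements and is constant on maximal ones, \<open>W\<close> is only multiplied by a power of
  \<open>t\<close>. The hypothesis on maximal elements allows us to choose \<open>q\<close> so that the new rank function takes
  its values in \<open>{0, 1}\<close> or in \<open>{-1, 0}\<close>, with a labeling that puts the lower rank first.

  For such a two-rank labeling, cut each linear extension into maximal runs of equal rank. The
  elements of a run form an antichain that may be permuted freely, so the extensions with a given
  sequence of runs contribute a power of \<open>t\<close> times a product of Eulerian polynomials. This product is
  gamma-positive, and its center of symmetry depends only on the ranks of the first and the last
  run. The first rank is fixed, so \<open>W\<close> is a sum of two gamma-positive polynomials whose centers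
  differ by one half, and is therefore unimodal.
\<close>

section \<open>Gamma-positive polynomials\<close>

text \<open>The nonnegative combinations of \<open>t^i (1 + t)^(d - 2 i)\<close>; thus \<open>d\<close> is twice the center of symmetry.\<close>

inductive gamma_pos :: "nat \<Rightarrow> nat poly \<Rightarrow> bool" where
  zero: "gamma_pos d 0"
| one: "gamma_pos 0 1"
| add: "gamma_pos d p \<Longrightarrow> gamma_pos d q \<Longrightarrow> gamma_pos d (p + q)"
| one_plus_X: "gamma_pos d p \<Longrightarrow> gamma_pos (Suc d) ([:1, 1:] * p)"
| X: "gamma_pos d p \<Longrightarrow> gamma_pos (Suc (Suc d)) ([:0, 1:] * p)"

lemma gamma_pos_sum: "(\<And>x. x \<in> A \<Longrightarrow> gamma_pos d (f x)) \<Longrightarrow> gamma_pos d (sum f A)"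
  by (induction A rule: infinite_finite_induct) (auto intro: gamma_pos.zero gamma_pos.add)

lemma gamma_pos_mult: "gamma_pos a p \<Longrightarrow> gamma_pos b q \<Longrightarrow> gamma_pos (a + b) (p * q)"
proof (induction rule: gamma_pos.induct)
  case (one_plus_X d p)
  then show ?case
    using gamma_pos.one_plus_X[of "d + b" "p * q"] by (simp only: mult.assoc add_Suc)
next
  case (X d p)
  then show ?case
    using gamma_pos.X[of "d + b" "p * q"] by (simp only: mult.assoc add_Suc)
qed (auto simp: distrib_right intro: gamma_pos.intros)

text \<open>The step from index \<open>j\<close> to \<open>Suc j\<close> has midpoint
  \<open>j + 1/2\<close>, so \<open>Suc (2 * j) \<le> d\<close> places it at or before the center
  \<open>d/2\<close>. The four properties go through one induction because monotonicity next to the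
  center, after multiplication by \<open>1 + t\<close>, relies on symmetry and on vanishing beyond
  \<open>d\<close>.\<close>

lemma gamma_pos_coeff:
  assumes "gamma_pos d p"
  shows "(\<forall>j. Suc (2 * j) \<le> d \<longrightarrow> coeff p j \<le> coeff p (Suc j)) \<and>
         (\<forall>j. d \<le> Suc (2 * j) \<longrightarrow> coeff p (Suc j) \<le> coeff p j) \<and>
         (\<forall>j\<le>d. coeff p j = coeff p (d - j)) \<and>
         (\<forall>j>d. coeff p j = 0)"
  using assms
proof (induction rule: gamma_pos.induct)
  case (zero d)
  then show ?case by simp
next
  case one
  then show ?case by simp
next
  case (add d p q)
  note p = add.IH(1) and q = add.IH(2)
  show ?case
    unfolding coeff_add
  proof (intro conjI allI impI)
    fix j assume "Suc (2 * j) \<le> d"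
    then show "coeff p j + coeff q j \<le> coeff p (Suc j) + coeff q (Suc j)"
      using p q by (blast intro: add_mono)
  next
    fix j assume "d \<le> Suc (2 * j)"
    then show "coeff p (Suc j) + coeff q (Suc j) \<le> coeff p j + coeff q j"
      using p q by (blast intro: add_mono)
  next
    fix j assume "j \<le> d"
    then show "coeff p j + coeff q j = coeff p (d - j) + coeff q (d - j)"
      using p q by metis
  next
    fix j assume "d < j"
    then show "coeff p j + coeff q j = 0"
      using p q by (metis add_0)
  qed
next
  case (one_plus_X d p)
  then have up: "\<And>j. Suc (2 * j) \<le> d \<Longrightarrow> coeff p j \<le> coeff p (Suc j)"
    and down: "\<And>j. d \<le> Suc (2 * j) \<Longrightarrow> coeff p (Suc j) \<le> coeff p j"
    and sym: "\<And>j. j \<le> d \<Longrightarrow> coeff p j = coeff p (d - j)"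
    and zero: "\<And>j. d < j \<Longrightarrow> coeff p j = 0"
    by blast+
  have c0: "coeff ([:1, 1:] * p) 0 = coeff p 0" by simp
  have cS: "coeff ([:1, 1:] * p) (Suc j) = coeff p (Suc j) + coeff p j" for j by simp
  \<comment> \<open>After multiplication by \<open>1 + t\<close> the difference at
    \<open>j > 0\<close> is \<open>coeff p (Suc j) - coeff p (j - 1)\<close>, a sum of two
    consecutive old differences. They have the same sign unless \<open>2 * j = d\<close>, where
    symmetry makes them cancel.\<close>
  have mid: "coeff p (Suc (Suc j)) = coeff p j" if "2 * Suc j = d" for j
  proof -
    have "d - j = Suc (Suc j)" "j \<le> d" using that by simp_all
    then show ?thesis using sym[of j] by simp
  qed
  show ?case
  proof (intro conjI allI impI)
    fix j assume j: "Suc (2 * j) \<le> Suc d"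
    show "coeff ([:1, 1:] * p) j \<le> coeff ([:1, 1:] * p) (Suc j)"
    proof (cases j)
      case (Suc i)
      show ?thesis
      proof (cases "2 * j = d")
        case True
        then show ?thesis using mid[of i] unfolding Suc cS by simp
      next
        case False
        then show ?thesis using up[of j] up[of i] j unfolding Suc cS by simp
      qed
    qed (simp only: c0 cS le_add2)
  next
    fix j assume j: "Suc d \<le> Suc (2 * j)"
    show "coeff ([:1, 1:] * p) (Suc j) \<le> coeff ([:1, 1:] * p) j"
    proof (cases j)
      case 0
      then show ?thesis using j zero[of 1] by simp
    next
      case (Suc i)
      show ?thesis
      proof (cases "2 * j = d")
        case True
        then show ?thesis using mid[of i] unfolding Suc cS by simp
      next
        case False
        then show ?thesis using down[of j] down[of i] j unfolding Suc cS by simp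
      qed
    qed
  next
    fix j assume j: "j \<le> Suc d"
    show "coeff ([:1, 1:] * p) j = coeff ([:1, 1:] * p) (Suc d - j)"
    proof (cases j)
      case 0
      then show ?thesis using sym[of 0] zero[of "Suc d"] unfolding 0 c0 diff_zero cS by simp
    next
      case (Suc i)
      show ?thesis
      proof (cases "i = d")
        case True
        then show ?thesis using sym[of 0] zero[of "Suc d"] unfolding Suc cS by simp
      next
        case False
        then obtain k where k: "d - i = Suc k" using j Suc by (cases "d - i") auto
        have "k = d - Suc i" using k by simp
        then show ?thesis using sym[of i] sym[of "Suc i"] False j k unfolding Suc diff_Suc_Suc k cS by simp
      qed
    qed
  next
    fix j assume j: "Suc d < j"
    then obtain i where i: "j = Suc i" by (cases j) auto
    show "coeff ([:1, 1:] * p) j = 0"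
      using zero[of i] zero[of "Suc i"] j unfolding i cS by simp
  qed
next
  case (X d p)
  then have up: "\<And>j. Suc (2 * j) \<le> d \<Longrightarrow> coeff p j \<le> coeff p (Suc j)"
    and down: "\<And>j. d \<le> Suc (2 * j) \<Longrightarrow> coeff p (Suc j) \<le> coeff p j"
    and sym: "\<And>j. j \<le> d \<Longrightarrow> coeff p j = coeff p (d - j)"
    and zero: "\<And>j. d < j \<Longrightarrow> coeff p j = 0"
    by blast+
  have c: "coeff ([:0, 1:] * p) j = (case j of 0 \<Rightarrow> 0 | Suc i \<Rightarrow> coeff p i)" for j
    by (cases j) simp_all
  show ?case
  proof (intro conjI allI impI)
    fix j assume j: "j \<le> Suc (Suc d)"
    show "coeff ([:0, 1:] * p) j = coeff ([:0, 1:] * p) (Suc (Suc d) - j)"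
    proof (cases j)
      case (Suc i)
      then show ?thesis unfolding c using sym[of i] zero[of "Suc d"] j
        by (cases "i = Suc d") (auto simp: Suc_diff_le)
    qed (simp add: c zero)
  qed (auto simp: c simp del: mult_pCons_left One_nat_def split: nat.split intro: up down zero)
qed

lemma unimodal_seqI:
  fixes a :: "nat \<Rightarrow> 'b::linorder"
  assumes "\<And>j. j < m \<Longrightarrow> a j \<le> a (Suc j)" and "\<And>j. m \<le> j \<Longrightarrow> a (Suc j) \<le> a j"
  shows "unimodal_seq a"
  unfolding unimodal_seq_def
proof (intro exI[of _ m] conjI allI impI; elim conjE)
  fix i j assume "i \<le> j" "j \<le> m"
  then show "a i \<le> a j"
  proof (induction j rule: dec_induct)
    case (step n)
    then show ?case using assms(1)[of n] by (auto intro: order_trans)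
  qed simp
next
  fix i j assume "i \<le> j" "m \<le> i"
  then show "a j \<le> a i"
  proof (induction j rule: dec_induct)
    case (step n)
    then show ?case using assms(2)[of n] by (auto intro: order_trans)
  qed simp
qed

text \<open>Both summands rise at \<open>j\<close> if \<open>2 j + 1 \<le> d\<close> and both fall
  if \<open>2 j + 1 \<ge> d + 1\<close>; no integer lies between, so they never disagree. The
  turning index is kept explicit because it is later moved by a degree shift.\<close>

lemma gamma_pos_add_unimodal:
  assumes "gamma_pos d p" "gamma_pos (Suc d) q"
  shows "\<exists>m. (\<forall>j<m. coeff (p + q) j \<le> coeff (p + q) (Suc j)) \<and>
             (\<forall>j\<ge>m. coeff (p + q) (Suc j) \<le> coeff (p + q) j)"
proof (intro exI[of _ "Suc d div 2"] conjI allI impI)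
  fix j assume "j < Suc d div 2"
  then have "Suc (2 * j) \<le> d" "Suc (2 * j) \<le> Suc d" by simp_all
  then have "coeff p j \<le> coeff p (Suc j)" "coeff q j \<le> coeff q (Suc j)"
    using gamma_pos_coeff[OF assms(1)] gamma_pos_coeff[OF assms(2)] by blast+
  then show "coeff (p + q) j \<le> coeff (p + q) (Suc j)" by simp
next
  fix j assume "Suc d div 2 \<le> j"
  then have "d \<le> Suc (2 * j)" "Suc d \<le> Suc (2 * j)" by simp_all
  then have "coeff p (Suc j) \<le> coeff p j" "coeff q (Suc j) \<le> coeff q j"
    using gamma_pos_coeff[OF assms(1)] gamma_pos_coeff[OF assms(2)] by blast+
  then show "coeff (p + q) (Suc j) \<le> coeff (p + q) j" by simp
qed

section \<open>Descents and Eulerian polynomials\<close>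

lemma des_Nil [simp]: "des [] = 0" and des_singleton [simp]: "des [x] = 0"
  by (simp_all add: des_def)

lemma des_Cons_Cons: "des (x # y # xs) = of_bool (y < x) + des (y # xs)"
proof -
  let ?S = "{i. Suc i < length (y # xs) \<and> (y # xs) ! i > (y # xs) ! Suc i}"
  have "{i. Suc i < length (x # y # xs) \<and> (x # y # xs) ! i > (x # y # xs) ! Suc i}
      = (if y < x then {0} else {}) \<union> Suc ` ?S" (is "?L = ?R")
  proof (rule set_eqI)
    fix i show "i \<in> ?L \<longleftrightarrow> i \<in> ?R" by (cases i) auto
  qed
  moreover have "finite ?S" by (rule finite_subset[of _ "{..length (y # xs)}"]) auto
  ultimately show ?thesis
    unfolding des_def by (simp add: card_Un_disjoint card_image)
qed

lemma des_append:
  "xs \<noteq> [] \<Longrightarrow> ys \<noteq> [] \<Longrightarrow> des (xs @ ys) = des xs + of_bool (hd ys < last xs) + des ys"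
proof (induction xs)
  case (Cons x xs)
  then show ?case
    by (cases xs; cases ys) (auto simp: des_Cons_Cons)
qed simp

text \<open>For finite \<open>B\<close> and \<open>f\<close> injective on it, this is the Eulerian
  polynomial of order \<open>card B\<close>, with descents as exponents. Indexing by the set lets
  the recursion run over its subsets.\<close>

definition eulerian_sum :: "('a \<Rightarrow> nat) \<Rightarrow> 'a set \<Rightarrow> nat poly" where
  "eulerian_sum f B = (\<Sum>u\<in>permutations_of_set B. monom 1 (des (map f u)))"

text \<open>Cut each word at its largest letter \<open>m\<close>, and let \<open>U\<close> be the
  set of letters before it. The entry into \<open>m\<close> is an ascent and the exit a descent,
  except that nothing follows \<open>m\<close> when \<open>U = B\<close>.\<close>

lemma eulerian_sum_insert_max:
  assumes fin: "finite B" and m: "m \<notin> B" and max: "\<And>x. x \<in> B \<Longrightarrow> f x < f m"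
  shows "eulerian_sum f (insert m B) =
    (\<Sum>U\<in>Pow B. monom 1 (of_bool (U \<noteq> B)) * eulerian_sum f U * eulerian_sum f (B - U))"
proof -
  let ?P = "\<lambda>U. permutations_of_set U"
  have d: "des (map f (u @ m # v)) = des (map f u) + des (map f v) + of_bool (U \<noteq> B)"
    if "U \<subseteq> B" "u \<in> ?P U" "v \<in> ?P (B - U)" for U u v
  proof -
    have u: "set u \<subseteq> B" "set v = B - U" using that by (auto simp: permutations_of_set_def)
    have "des (map f (m # v)) = des (map f v) + of_bool (v \<noteq> [])"
      using u max by (cases v) (auto simp: des_Cons_Cons)
    moreover have "des (map f (u @ m # v)) = des (map f u) + des (map f (m # v))"
    proof (cases "u = []")
      case False
      then have "f (last u) < f m" using u max last_in_set[of u] by blast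
      then show ?thesis using False des_append[of "map f u" "map f (m # v)"]
        by (auto simp: last_map)
    qed simp
    moreover have "v \<noteq> [] \<longleftrightarrow> U \<noteq> B" using u \<open>U \<subseteq> B\<close> by auto
    ultimately show ?thesis by simp
  qed
  have split: "takeWhile (\<lambda>x. x \<noteq> m) (u @ m # v) = u" "dropWhile (\<lambda>x. x \<noteq> m) (u @ m # v) = m # v"
    if "m \<notin> set u" for u v
    using that by (induction u) auto
  have "eulerian_sum f (insert m B) =
    (\<Sum>(U, u, v)\<in>(SIGMA U:Pow B. ?P U \<times> ?P (B - U)). monom 1 (des (map f (u @ m # v))))"
    unfolding eulerian_sum_def
  proof (rule sum.reindex_bij_witness[where
      i = "\<lambda>(U, u, v). u @ m # v" and
      j = "\<lambda>w. (set (takeWhile (\<lambda>x. x \<noteq> m) w), takeWhile (\<lambda>x. x \<noteq> m) w,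
                tl (dropWhile (\<lambda>x. x \<noteq> m) w))"], goal_cases)
    case (1 w)
    then have "m \<in> set w" by (auto simp: permutations_of_set_def)
    then obtain u v where "w = u @ m # v" "m \<notin> set u" by (meson split_list_first)
    then show ?case by (simp add: split)
  next
    case (2 w)
    then have w: "distinct w" "set w = insert m B" by (auto simp: permutations_of_set_def)
    then obtain u v where "w = u @ m # v" "m \<notin> set u" by (metis insertI1 split_list_first)
    then show ?case using w m by (auto simp: permutations_of_set_def split)
  next
    case (3 a)
    then obtain U u v where "a = (U, u, v)" "set u = U" "m \<notin> set u"
      using m by (auto simp: permutations_of_set_def)
    then show ?case by (simp add: split)
  next
    case (4 a)
    then show ?case using m by (auto simp: permutations_of_set_def)
  next
    case (5 w)
    then have "m \<in> set w" by (auto simp: permutations_of_set_def)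
    then obtain u v where "w = u @ m # v" "m \<notin> set u" by (meson split_list_first)
    then show ?case by (simp add: split)
  qed
  also have "\<dots> = (\<Sum>U\<in>Pow B. \<Sum>(u, v)\<in>?P U \<times> ?P (B - U). monom 1 (des (map f (u @ m # v))))"
    using fin by (subst sum.Sigma) (auto intro: finite_subset)
  also have "\<dots> = (\<Sum>U\<in>Pow B. \<Sum>(u, v)\<in>?P U \<times> ?P (B - U).
      monom 1 (of_bool (U \<noteq> B)) * monom 1 (des (map f u)) * monom 1 (des (map f v)))"
  proof (intro sum.cong refl, clarify)
    fix U u v assume "U \<subseteq> B" "u \<in> ?P U" "v \<in> ?P (B - U)"
    note d = d[OF this]
    show "monom (1::nat) (des (map f (u @ m # v))) =
        monom 1 (of_bool (U \<noteq> B)) * monom 1 (des (map f u)) * monom 1 (des (map f v))"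
      unfolding d mult_monom by (simp only: ac_simps mult_1)
  qed
  also have "\<dots> = (\<Sum>U\<in>Pow B. monom 1 (of_bool (U \<noteq> B)) * eulerian_sum f U * eulerian_sum f (B - U))"
    unfolding eulerian_sum_def
    by (intro sum.cong refl) (simp only: mult.assoc sum_product,
          simp only: sum.cartesian_product[symmetric] sum_distrib_left)
  finally show ?thesis .
qed

lemma eulerian_sum_empty [simp]: "eulerian_sum f {} = 1"
  by (simp add: eulerian_sum_def monom_0 one_pCons)

text \<open>Remove the letter with the largest label, leaving \<open>C\<close>. The extreme terms
  \<open>U = {}\<close> and \<open>U = C\<close> of the recursion combine to \<open>(1 + t)\<close>
  times the polynomial of \<open>C\<close>. Every other term is \<open>t\<close> times a product
  with parameter \<open>(card U - 1) + (card (C - U) - 1)\<close>, and the factor \<open>t\<close>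
  raises this to \<open>card C\<close>.\<close>

lemma gamma_pos_eulerian_sum:
  assumes "finite B" "B \<noteq> {}" "inj_on f B"
  shows "gamma_pos (card B - 1) (eulerian_sum f B)"
  using assms
proof (induction "card B" arbitrary: B rule: less_induct)
  case less
  obtain m where m: "m \<in> B" "f m = Max (f ` B)"
    using less.prems by (metis (no_types) Max_in finite_imageI image_iff image_is_empty)
  define C where "C = B - {m}"
  have B: "B = insert m C" "m \<notin> C" "finite C" and card_B: "card B = Suc (card C)"
    using m less.prems by (auto simp: C_def card_Diff_singleton card_gt_0_iff)
  have max: "f x < f m" if "x \<in> C" for x
  proof -
    have "f x \<le> f m" using that m less.prems by (simp add: C_def)
    moreover have "f x \<noteq> f m" using that m less.prems by (auto simp: C_def inj_on_def)
    ultimately show ?thesis by simp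
  qed
  have IH: "gamma_pos (card U - 1) (eulerian_sum f U)" if "U \<subseteq> C" "U \<noteq> {}" for U
  proof (rule less.hyps)
    show "card U < card B" using card_mono[OF \<open>finite C\<close> that(1)] card_B by simp
  qed (use that B less.prems in \<open>auto intro: finite_subset inj_on_subset\<close>)
  let ?g = "\<lambda>U. monom 1 (of_bool (U \<noteq> C)) * eulerian_sum f U * eulerian_sum f (C - U)"
  have X: "monom (1::nat) (Suc 0) = [:0, 1:]" by (simp add: monom_Suc monom_0)
  show ?case
  proof (cases "C = {}")
    case True
    then show ?thesis
      using B gamma_pos.one eulerian_sum_insert_max[of "{}" m f] by (simp add: monom_0 one_pCons)
  next
    case False
    have "gamma_pos (card C) (\<Sum>U\<in>Pow C - {{}, C}. ?g U)"
    proof (rule gamma_pos_sum)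
      fix U assume U: "U \<in> Pow C - {{}, C}"
      have c: "card (C - U) = card C - card U" "0 < card U" "card U < card C"
        using U B by (auto simp: card_Diff_subset finite_subset card_gt_0_iff intro: psubset_card_mono)
      have "gamma_pos (Suc (Suc ((card U - 1) + (card (C - U) - 1))))
              ([:0, 1:] * (eulerian_sum f U * eulerian_sum f (C - U)))"
        using U by (intro gamma_pos.X gamma_pos_mult IH) auto
      moreover have "Suc (Suc ((card U - 1) + (card (C - U) - 1))) = card C" using c by simp
      moreover have "?g U = [:0, 1:] * (eulerian_sum f U * eulerian_sum f (C - U))"
        using U unfolding X[symmetric] mult.assoc by simp
      ultimately show "gamma_pos (card C) (?g U)" by metis
    qed
    moreover have "gamma_pos (card C) ([:1, 1:] * eulerian_sum f C)"
      using gamma_pos.one_plus_X[OF IH[of C]] False B by (simp add: card_gt_0_iff)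
    moreover have "(\<Sum>U\<in>Pow C. ?g U) = [:1, 1:] * eulerian_sum f C + (\<Sum>U\<in>Pow C - {{}, C}. ?g U)"
    proof -
      have "(\<Sum>U\<in>Pow C. ?g U) = (\<Sum>U\<in>{{}, C}. ?g U) + (\<Sum>U\<in>Pow C - {{}, C}. ?g U)"
        using B by (subst sum.subset_diff[of "{{}, C}"]) (auto simp: add.commute)
      moreover have "[:1, 1:] = monom 1 0 + monom (1::nat) (Suc 0)"
        by (simp add: monom_Suc monom_0)
      ultimately show ?thesis using False by (simp add: distrib_right add.commute del: mult_pCons_left)
    qed
    ultimately show ?thesis
      using B max card_B by (simp add: eulerian_sum_insert_max gamma_pos.add)
  qed
qed

section \<open>Words with two colors\<close>

text \<open>Storing each maximal run as a set forgets the order inside it, so the fibers consist of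
  words that differ by permutations within runs.\<close>

fun color_blocks :: "('a \<Rightarrow> bool) \<Rightarrow> 'a list \<Rightarrow> 'a set list" where
  "color_blocks c [] = []"
| "color_blocks c [x] = [{x}]"
| "color_blocks c (x # y # xs) =
    (let K = color_blocks c (y # xs)
     in if c x = c y then insert x (hd K) # tl K else {x} # K)"

fun block_words :: "'a set list \<Rightarrow> 'a list set" where
  "block_words [] = {[]}"
| "block_words (B # K) = (\<lambda>(u, v). u @ v) ` (permutations_of_set B \<times> block_words K)"

text \<open>Alternation ensures that neighboring blocks cannot merge, so that a word spelled from
  the blocks has exactly these as its runs.\<close>

fun alternating_blocks :: "('a \<Rightarrow> bool) \<Rightarrow> bool \<Rightarrow> 'a set list \<Rightarrow> bool" where
  "alternating_blocks c s [] = True"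
| "alternating_blocks c s (B # K) =
    (finite B \<and> B \<noteq> {} \<and> (\<forall>x\<in>B. c x = s) \<and> alternating_blocks c (\<not> s) K)"

lemma color_blocks_neq_Nil [simp]: "color_blocks c xs = [] \<longleftrightarrow> xs = []"
  by (induction c xs rule: color_blocks.induct) (auto simp: Let_def)

lemma color_blocks_append:
  assumes "xs \<noteq> []" "\<forall>x\<in>set xs. c x = s" "ys \<noteq> [] \<Longrightarrow> c (hd ys) \<noteq> s"
  shows "color_blocks c (xs @ ys) = set xs # color_blocks c ys"
  using assms
proof (induction xs)
  case (Cons x xs)
  show ?case
  proof (cases xs)
    case Nil
    then show ?thesis using Cons.prems by (cases ys) auto
  next
    case xs: (Cons y zs)
    then show ?thesis using Cons by (simp add: Let_def)
  qed
qed simp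

lemma alternating_color_blocks:
  "xs \<noteq> [] \<Longrightarrow> alternating_blocks c (c (hd xs)) (color_blocks c xs)"
proof (induction c xs rule: color_blocks.induct)
  case (3 c x y xs)
  then obtain B K where "color_blocks c (y # xs) = B # K"
    by (metis color_blocks_neq_Nil list.distinct(1) neq_Nil_conv)
  then show ?case using 3 by (auto simp: Let_def)
qed auto

lemma block_words_length:
  "w \<in> block_words K \<Longrightarrow> length w = (\<Sum>B\<leftarrow>K. card B)"
  by (induction K arbitrary: w) (auto simp: permutations_of_set_def distinct_card)

lemma block_words_set: "w \<in> block_words K \<Longrightarrow> set w = \<Union> (set K)"
  by (induction K arbitrary: w) (auto simp: permutations_of_set_def)

lemma in_block_words_color_blocks:
  "distinct xs \<Longrightarrow> xs \<in> block_words (color_blocks c xs)"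
proof (induction c xs rule: color_blocks.induct)
  case (2 c x)
  then show ?case by (auto simp: permutations_of_set_def image_iff)
next
  case (3 c x y xs)
  obtain B K where BK: "color_blocks c (y # xs) = B # K"
    by (metis color_blocks_neq_Nil list.distinct(1) neq_Nil_conv)
  have "y # xs \<in> block_words (B # K)" using 3 BK by simp
  then obtain u v where uv: "u @ v = y # xs" "u \<in> permutations_of_set B" "v \<in> block_words K"
    by auto
  have "x \<notin> set u" using 3(2) uv(1) by (metis Un_iff distinct.simps(2) set_append)
  then have xu: "x # u \<in> permutations_of_set (insert x B)" "[x] \<in> permutations_of_set {x}"
    using uv by (auto simp: permutations_of_set_def)
  show ?case
  proof (cases "c x = c y")
    case True
    have "x # y # xs = (\<lambda>(u, v). u @ v) (x # u, v)" using uv by simp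
    then have "x # y # xs \<in> block_words (insert x B # K)"
      unfolding block_words.simps using xu uv by blast
    then show ?thesis using True BK by (simp add: Let_def)
  next
    case False
    have "x # y # xs = (\<lambda>(u, v). u @ v) ([x], y # xs)" by simp
    then have "x # y # xs \<in> block_words ({x} # B # K)"
      unfolding block_words.simps(2)[of "{x}"] using xu \<open>y # xs \<in> block_words (B # K)\<close> by blast
    then show ?thesis using False BK by (simp add: Let_def)
  qed
qed simp

lemma block_words_hd:
  "w \<in> block_words K \<Longrightarrow> alternating_blocks c s K \<Longrightarrow> K \<noteq> [] \<Longrightarrow> w \<noteq> [] \<and> c (hd w) = s"
proof (cases K)
  case (Cons B K')
  assume "w \<in> block_words K" "alternating_blocks c s K"
  then obtain u v where "w = u @ v" "set u = B" "B \<noteq> {}" "\<forall>x\<in>B. c x = s"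
    using Cons by (auto simp: permutations_of_set_def)
  then show ?thesis by (cases u) auto
qed simp

text \<open>Together with \<open>in_block_words_color_blocks\<close> this identifies, among distinct
  words, the fiber of \<open>color_blocks c\<close> over an alternating \<open>K\<close> with
  \<open>block_words K\<close>.\<close>

lemma color_blocks_block_words:
  "w \<in> block_words K \<Longrightarrow> alternating_blocks c s K \<Longrightarrow> color_blocks c w = K"
proof (induction K arbitrary: w s)
  case (Cons B K)
  then obtain u v where uv: "w = u @ v" "set u = B" "v \<in> block_words K"
    by (auto simp: permutations_of_set_def)
  have "v \<noteq> [] \<Longrightarrow> c (hd v) \<noteq> s"
    using block_words_hd[OF uv(3), of c "\<not> s"] Cons.prems uv(3) by (cases "K = []") auto
  then show ?case
    using uv Cons.IH[OF uv(3)] Cons.prems color_blocks_append[of u c s v] by auto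
qed simp

text \<open>Labels of color \<open>True\<close> exceed those of color \<open>False\<close>, so a
  junction of blocks is a descent exactly when the color passes from \<open>True\<close> to
  \<open>False\<close>. With \<open>k\<close> blocks and \<open>r\<close> such junctions, the sum is
  \<open>t^r\<close> times a product of Eulerian polynomials, and \<open>d = n - k + 2 r\<close>.
  Since the junctions alternate, \<open>2 r = k - 1 + [s] - [e]\<close>, so \<open>k\<close>
  cancels. The equation for \<open>d\<close> is written without subtraction.\<close>

lemma gamma_pos_block_words:
  assumes "alternating_blocks c s K" "K \<noteq> []"
    and inj: "\<And>B. B \<in> set K \<Longrightarrow> inj_on f B"
    and mono: "\<And>x y. x \<in> \<Union> (set K) \<Longrightarrow> y \<in> \<Union> (set K) \<Longrightarrow> \<not> c x \<Longrightarrow> c y \<Longrightarrow> f x < f y"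
  shows "\<exists>e d. (\<forall>w\<in>block_words K. c (last w) = e) \<and>
           Suc d + of_bool e = (\<Sum>B\<leftarrow>K. card B) + of_bool s \<and>
           gamma_pos d (\<Sum>w\<in>block_words K. monom 1 (des (map f w)))"
  using assms
proof (induction K arbitrary: s)
  case (Cons B K)
  have B: "finite B" "B \<noteq> {}" "\<forall>x\<in>B. c x = s" "alternating_blocks c (\<not> s) K"
    using Cons.prems by auto
  have E: "gamma_pos (card B - 1) (eulerian_sum f B)"
    using B Cons.prems by (intro gamma_pos_eulerian_sum) auto
  have cB: "0 < card B" using B by (simp add: card_gt_0_iff)
  \<comment> \<open>All arrangements of \<open>B\<close> have the same length, so the cutting point
    of a concatenation is determined.\<close>
  have inj: "inj_on (\<lambda>(u, v). u @ v) (permutations_of_set B \<times> block_words K)"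
  proof (rule inj_onI, clarify)
    fix u v u' v'
    assume "u \<in> permutations_of_set B" "u' \<in> permutations_of_set B" "u @ v = u' @ v'"
    then show "u = u' \<and> v = v'"
      by (metis append_eq_append_conv length_finite_permutations_of_set)
  qed
  have sum: "(\<Sum>w\<in>block_words (B # K). monom (1::nat) (des (map f w))) =
      (\<Sum>u\<in>permutations_of_set B. \<Sum>v\<in>block_words K. monom 1 (des (map f (u @ v))))"
    unfolding block_words.simps sum.reindex[OF inj] sum.cartesian_product
    by (intro sum.cong) auto
  show ?case
  proof (cases "K = []")
    case True
    have "c (last w) = s" if "w \<in> block_words [B]" for w
    proof -
      have "w \<noteq> []" "set w = B" using that B by (auto simp: permutations_of_set_def)
      then have "last w \<in> B" using last_in_set[of w] by blast
      then show ?thesis using B by blast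
    qed
    moreover have "(\<Sum>w\<in>block_words [B]. monom (1::nat) (des (map f w))) = eulerian_sum f B"
      using sum True by (simp add: eulerian_sum_def)
    ultimately show ?thesis
      using True E cB by (intro exI[of _ s] exI[of _ "card B - 1"]) auto
  next
    case False
    obtain e d where e: "\<And>v. v \<in> block_words K \<Longrightarrow> c (last v) = e"
      and d: "Suc d + of_bool e = (\<Sum>B\<leftarrow>K. card B) + of_bool (\<not> s)"
      and g: "gamma_pos d (\<Sum>v\<in>block_words K. monom 1 (des (map f v)))"
      using Cons.IH[OF B(4) False] Cons.prems(3,4) by (metis (no_types, lifting) UnCI Union_insert list.set(2) list.set_intros(2))
    have des: "des (map f (u @ v)) = of_bool s + des (map f u) + des (map f v)"
      if "u \<in> permutations_of_set B" "v \<in> block_words K" for u v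
    proof -
      have v: "v \<noteq> []" "c (hd v) = (\<not> s)" using block_words_hd[OF that(2) B(4) False] by auto
      have u: "u \<noteq> []" "set u = B" using that B by (auto simp: permutations_of_set_def)
      then have "last u \<in> B" "c (last u) = s" using B last_in_set[of u] by blast+
      moreover have "hd v \<in> \<Union> (set K)" using v block_words_set[OF that(2)] by (metis hd_in_set)
      ultimately have "f (hd v) < f (last u) \<longleftrightarrow> s"
        using v Cons.prems(4)[of "hd v" "last u"] Cons.prems(4)[of "last u" "hd v"]
        by (cases s) auto
      then show ?thesis
        using u v des_append[of "map f u" "map f v"] by (simp add: last_map hd_map)
    qed
    have sum': "(\<Sum>w\<in>block_words (B # K). monom (1::nat) (des (map f w))) =
        monom 1 (of_bool s) * (eulerian_sum f B * (\<Sum>v\<in>block_words K. monom 1 (des (map f v))))"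
      unfolding sum eulerian_sum_def sum_product unfolding sum_distrib_left
      by (intro sum.cong refl) (simp only: des mult_monom add.assoc mult_1)
    have EK: "gamma_pos (card B - 1 + d) (eulerian_sum f B * (\<Sum>v\<in>block_words K. monom 1 (des (map f v))))"
      by (rule gamma_pos_mult[OF E g])
    have "\<exists>d'. Suc d' + of_bool e = (\<Sum>B\<leftarrow>B # K. card B) + of_bool s \<and>
           gamma_pos d' (\<Sum>w\<in>block_words (B # K). monom 1 (des (map f w)))"
    proof (cases s)
      case True
      have "monom (1::nat) (of_bool s) = [:0, 1:]" using True by (simp add: monom_Suc monom_0)
      then have "gamma_pos (Suc (Suc (card B - 1 + d))) (\<Sum>w\<in>block_words (B # K). monom 1 (des (map f w)))"
        using gamma_pos.X[OF EK] unfolding sum' by metis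
      then show ?thesis using True cB d by (intro exI[of _ "Suc (Suc (card B - 1 + d))"]) auto
    next
      case False
      have "monom (1::nat) (of_bool s) = 1" using False by (simp add: monom_0 one_pCons)
      then have "gamma_pos (card B - 1 + d) (\<Sum>w\<in>block_words (B # K). monom 1 (des (map f w)))"
        using EK unfolding sum' by (metis mult_1)
      then show ?thesis using False cB d by (intro exI[of _ "card B - 1 + d"]) auto
    qed
    then obtain d' where "Suc d' + of_bool e = (\<Sum>B\<leftarrow>B # K. card B) + of_bool s"
      and "gamma_pos d' (\<Sum>w\<in>block_words (B # K). monom 1 (des (map f w)))"
      by (elim exE conjE)
    moreover have "c (last w) = e" if w: "w \<in> block_words (B # K)" for w
    proof -
      obtain u v where uv: "w = u @ v" "v \<in> block_words K" using w by auto
      then show ?thesis using e[OF uv(2)] block_words_hd[OF uv(2) B(4) False] by simp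
    qed
    ultimately show ?thesis by (intro exI[of _ e] exI[of _ d'] conjI ballI)
  qed
qed simp

text \<open>\<open>L\<close> is a disjoint union of classes \<open>block_words K\<close>. Once first
  color, last color and length are fixed, all classes share the same center, so their gamma-positive
  sums may be added.\<close>

lemma gamma_pos_color_closed:
  assumes fin: "finite L" and L: "\<And>w. w \<in> L \<Longrightarrow> w \<noteq> [] \<and> distinct w \<and> length w = n \<and> c (hd w) = s \<and> set w = P"
    and closed: "\<And>w w'. w \<in> L \<Longrightarrow> w' \<in> block_words (color_blocks c w) \<Longrightarrow> w' \<in> L"
    and inj: "inj_on f P"
    and mono: "\<And>x y. x \<in> P \<Longrightarrow> y \<in> P \<Longrightarrow> \<not> c x \<Longrightarrow> c y \<Longrightarrow> f x < f y"
    and d: "Suc d + of_bool e = n + of_bool s"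
  shows "gamma_pos d (\<Sum>w | w \<in> L \<and> c (last w) = e. monom 1 (des (map f w)))"
proof -
  let ?L = "{w \<in> L. c (last w) = e}"
  have "(\<Sum>w\<in>?L. monom (1::nat) (des (map f w))) =
     (\<Sum>K\<in>color_blocks c ` ?L. \<Sum>w | w \<in> ?L \<and> color_blocks c w = K. monom 1 (des (map f w)))"
    using fin by (intro sum.image_gen) auto
  moreover have "gamma_pos d \<dots>"
  proof (rule gamma_pos_sum)
    fix K assume "K \<in> color_blocks c ` ?L"
    then obtain w where w: "w \<in> L" "c (last w) = e" "K = color_blocks c w" by auto
    note Lw = L[OF w(1)]
    have alt: "alternating_blocks c s K" "K \<noteq> []"
      using alternating_color_blocks[of w c] Lw w by auto
    have wK: "w \<in> block_words K" using in_block_words_color_blocks Lw w by blast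
    have UK: "\<Union> (set K) = P" using block_words_set[OF wK] Lw by simp
    have n: "(\<Sum>B\<leftarrow>K. card B) = n" using block_words_length[OF wK] Lw by simp
    obtain e' d' where e': "\<And>w. w \<in> block_words K \<Longrightarrow> c (last w) = e'"
      and d': "Suc d' + of_bool e' = n + of_bool s"
      and g: "gamma_pos d' (\<Sum>w\<in>block_words K. monom 1 (des (map f w)))"
      using gamma_pos_block_words[OF alt, of f] inj mono unfolding UK n
      by (metis (no_types, lifting) UK Union_upper inj_on_subset)
    have "e' = e" using e'[OF wK] w by simp
    moreover have "{w \<in> ?L. color_blocks c w = K} = block_words K"
    proof (intro equalityI subsetI)
      fix w' assume "w' \<in> {w \<in> ?L. color_blocks c w = K}"
      then show "w' \<in> block_words K" using L in_block_words_color_blocks by blast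
    next
      fix w' assume "w' \<in> block_words K"
      then show "w' \<in> {w \<in> ?L. color_blocks c w = K}"
        using closed[OF w(1)] w(3) color_blocks_block_words[OF _ alt(1)] e' \<open>e' = e\<close> by auto
    qed
    moreover have "d' = d" using d d' \<open>e' = e\<close> by simp
    ultimately show "gamma_pos d (\<Sum>w | w \<in> ?L \<and> color_blocks c w = K. monom 1 (des (map f w)))"
      using g by simp
  qed
  ultimately show ?thesis by simp
qed

lemma color_blocks_monochrome:
  assumes "alternating_blocks c s K" "B \<in> set K" "x \<in> B" "y \<in> B"
  shows "c x = c y"
  using assms by (induction K arbitrary: s) auto

text \<open>Letters of different blocks keep their relative order under rearrangement within blocks.
  Sortedness therefore yields a condition between blocks; \<open>sorted_wrt_block_words\<close>
  returns from it once the letters inside each block are unconstrained.\<close>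

lemma sorted_wrt_color_blocks:
  assumes "sorted_wrt R w" "distinct w"
  shows "sorted_wrt (\<lambda>A B. \<forall>a\<in>A. \<forall>b\<in>B. R a b) (color_blocks c w)"
proof -
  have "sorted_wrt R w \<Longrightarrow> w \<in> block_words K \<Longrightarrow> sorted_wrt (\<lambda>A B. \<forall>a\<in>A. \<forall>b\<in>B. R a b) K" for K
    by (induction K arbitrary: w)
      (auto simp: sorted_wrt_append permutations_of_set_def dest: block_words_set)
  then show ?thesis using assms in_block_words_color_blocks by blast
qed

lemma sorted_wrt_block_words:
  assumes "w \<in> block_words K" "sorted_wrt (\<lambda>A B. \<forall>a\<in>A. \<forall>b\<in>B. R a b) K"
    and "\<And>B x y. B \<in> set K \<Longrightarrow> x \<in> B \<Longrightarrow> y \<in> B \<Longrightarrow> x \<noteq> y \<Longrightarrow> R x y"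
  shows "sorted_wrt R w"
  using assms
proof (induction K arbitrary: w)
  case (Cons B K)
  obtain u v where uv: "w = u @ v" "u \<in> permutations_of_set B" "v \<in> block_words K"
    using Cons.prems by auto
  have u: "set u = B" "distinct u" using uv by (auto simp: permutations_of_set_def)
  then have "sorted_wrt R u"
    using Cons.prems(3)[of B] by (auto simp: sorted_wrt_iff_nth_less distinct_conv_nth)
  moreover have "sorted_wrt R v" using Cons.IH[OF uv(3)] Cons.prems by auto
  ultimately show ?case
    using uv u block_words_set[OF uv(3)] Cons.prems(2) by (auto simp: sorted_wrt_append)
qed simp

section \<open>Linear extensions and rearrangement within color blocks\<close>

lemma linear_extensions_sorted_wrt:
  "linear_extensions P le = {xs. distinct xs \<and> set xs = P \<and> sorted_wrt (\<lambda>a b. \<not> le b a) xs}"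
proof -
  have "(\<forall>i<length xs. \<forall>j<length xs. le (xs ! i) (xs ! j) \<longrightarrow> i \<le> j) \<longleftrightarrow>
        sorted_wrt (\<lambda>a b. \<not> le b a) xs" for xs :: "'a list"
    unfolding sorted_wrt_iff_nth_less not_less[symmetric] by (auto dest: less_trans)
  then show ?thesis by (simp add: linear_extensions_def)
qed

lemma finite_linear_extensions: "finite P \<Longrightarrow> finite (linear_extensions P le)"
  by (rule finite_subset[OF _ finite_permutations_of_set[of P]])
    (auto simp: linear_extensions_def permutations_of_set_def)

text \<open>A comparable pair inside a monochrome block of a linear extension would be separated by an
  element of the other color.\<close>

lemma linear_extensions_block_closed:
  assumes sep: "\<And>x y. x \<in> P \<Longrightarrow> y \<in> P \<Longrightarrow> pless le x y \<Longrightarrow> c x = c y \<Longrightarrow>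
      \<exists>z\<in>P. c z \<noteq> c x \<and> le x z \<and> le z y"
    and w: "w \<in> linear_extensions P le" and w': "w' \<in> block_words (color_blocks c w)"
  shows "w' \<in> linear_extensions P le"
proof -
  let ?R = "\<lambda>a b. \<not> le b a" and ?K = "color_blocks c w"
  have dw: "distinct w" "set w = P" "sorted_wrt ?R w"
    using w by (auto simp: linear_extensions_sorted_wrt)
  have wK: "w \<in> block_words ?K" using in_block_words_color_blocks dw by blast
  have K: "sorted_wrt (\<lambda>A B. \<forall>a\<in>A. \<forall>b\<in>B. ?R a b) ?K"
    using sorted_wrt_color_blocks[OF dw(3,1)] .
  have UK: "\<Union> (set ?K) = P" using block_words_set[OF wK] dw by simp
  have block: "?R y x" if B: "B \<in> set ?K" and xy: "x \<in> B" "y \<in> B" "x \<noteq> y" for B x y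
  proof
    assume "le x y"
    have "w \<noteq> []" using B by auto
    have mono: "c a = c b" if "A \<in> set ?K" "a \<in> A" "b \<in> A" for A a b
      using color_blocks_monochrome[OF alternating_color_blocks[OF \<open>w \<noteq> []\<close>] that] .
    obtain z where z: "z \<in> P" "c z \<noteq> c x" "le x z" "le z y"
      using sep[of x y] xy B UK mono[OF B xy(1,2)] \<open>le x y\<close> by (auto simp: pless_def)
    obtain A where A: "A \<in> set ?K" "z \<in> A" using z UK by blast
    have "A \<noteq> B" using mono[of B z x] A B xy z by auto
    then obtain i j where ij: "i < length ?K" "j < length ?K" "?K ! i = A" "?K ! j = B" "i \<noteq> j"
      using A B by (metis in_set_conv_nth)
    then consider "i < j" | "j < i" by linarith
    then show False
    proof cases
      case 1
      then have "?R z x" using sorted_wrt_nth_less[OF K 1] ij A xy by auto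
      then show False using z by simp
    next
      case 2
      then have "?R y z" using sorted_wrt_nth_less[OF K 2] ij A xy by auto
      then show False using z by simp
    qed
  qed
  have "sorted_wrt ?R w'"
    by (rule sorted_wrt_block_words[OF w' K]) (use block in blast)
  moreover have "set w' = P" using block_words_set[OF w'] UK by simp
  \<comment> \<open>By counting: \<open>w'\<close> has the same length as \<open>w\<close>, namely
    \<open>card P\<close>, and its letters fill \<open>P\<close>.\<close>
  moreover have "distinct w'"
    using block_words_length[OF w'] block_words_length[OF wK] dw \<open>set w' = P\<close>
    by (metis card_distinct distinct_card)
  ultimately show ?thesis by (simp add: linear_extensions_sorted_wrt)
qed

section \<open>Labeled poset partitions\<close>

text \<open>One transitive relation covers both cases of a labeled partition:
  \<open>\<sigma>\<close> may not decrease from \<open>x\<close> to \<open>y\<close>, and must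
  increase where the label drops.\<close>

definition lex_less :: "('a \<Rightarrow> int) \<Rightarrow> ('a \<Rightarrow> nat) \<Rightarrow> 'a \<Rightarrow> 'a \<Rightarrow> bool" where
  "lex_less \<sigma> \<omega> x y \<longleftrightarrow> (\<sigma> x, \<omega> x) < (\<sigma> y, \<omega> y)"

lemma transp_lex_less: "transp (lex_less \<sigma> \<omega>)"
  by (auto simp: lex_less_def transp_def)

text \<open>Extensional functions make the set finite when \<open>P\<close> is. The bound is an
  integer because rank shifts may move it in either direction.\<close>

definition omega_partitions ::
  "'a set \<Rightarrow> ('a \<Rightarrow> 'a \<Rightarrow> bool) \<Rightarrow> ('a \<Rightarrow> nat) \<Rightarrow> int \<Rightarrow> ('a \<Rightarrow> int) set" where
  "omega_partitions P le \<omega> n =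
    {\<sigma> \<in> P \<rightarrow>\<^sub>E {0..n}. \<forall>x\<in>P. \<forall>y\<in>P. pless le x y \<longrightarrow> lex_less \<sigma> \<omega> x y}"

lemma lex_sorted_list_exists:
  assumes "finite P" "inj_on \<omega> P"
  shows "\<exists>w. distinct w \<and> set w = P \<and> sorted_wrt (lex_less \<sigma> \<omega>) w"
proof -
  let ?k = "\<lambda>x. (\<sigma> x, \<omega> x)"
  let ?s = "sorted_list_of_set (?k ` P)"
  let ?w = "map (inv_into P ?k) ?s"
  have inj: "inj_on ?k P" using assms by (auto simp: inj_on_def)
  have "map ?k ?w = ?s"
    unfolding map_map
  proof (rule map_idI)
    fix a assume "a \<in> set ?s"
    then have "a \<in> ?k ` P" using assms by simp
    then show "(?k \<circ> inv_into P ?k) a = a" using f_inv_into_f[of a ?k P] by simp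
  qed
  then have "sorted_wrt (<) (map ?k ?w)" "distinct (map ?k ?w)"
    by (simp_all only: strict_sorted_list_of_set distinct_sorted_list_of_set)
  then have "sorted_wrt (lex_less \<sigma> \<omega>) ?w" "distinct ?w"
    unfolding lex_less_def[abs_def] by (simp_all only: sorted_wrt_map distinct_map)
  moreover have "set ?w = P" using assms inj by (auto simp: image_image inv_into_f_f[OF inj])
  ultimately show ?thesis by blast
qed

lemma lex_sorted_list_unique:
  assumes "set w = set w'" "sorted_wrt (lex_less \<sigma> \<omega>) w" "sorted_wrt (lex_less \<sigma> \<omega>) w'"
    and "inj_on \<omega> (set w)"
  shows "w = w'"
proof -
  let ?k = "\<lambda>x. (\<sigma> x, \<omega> x)"
  have "sorted_wrt (<) (map ?k w)" "sorted_wrt (<) (map ?k w')"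
    using assms by (simp_all add: sorted_wrt_map lex_less_def[abs_def])
  then have "map ?k w = map ?k w'"
    by (rule strict_sorted_equal[symmetric]) (simp_all only: set_map assms(1))
  moreover have "inj_on ?k (set w \<union> set w')"
    using assms(4) unfolding assms(1)[symmetric] Un_absorb inj_on_def by blast
  ultimately show ?thesis by (rule map_inj_on)
qed

text \<open>Stanley's decomposition: each partition is compatible with exactly one linear extension,
  obtained by sorting \<open>P\<close> by \<open>\<sigma>\<close> and breaking ties by
  \<open>\<omega>\<close>.\<close>

lemma card_omega_partitions:
  assumes P: "finite P" and inj: "inj_on \<omega> P"
  shows "card (omega_partitions P le \<omega> n) =
    (\<Sum>w\<in>linear_extensions P le. card {\<sigma> \<in> P \<rightarrow>\<^sub>E {0..n}. sorted_wrt (lex_less \<sigma> \<omega>) w})"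
proof -
  let ?A = "\<lambda>w. {\<sigma> \<in> P \<rightarrow>\<^sub>E {0..n}. sorted_wrt (lex_less \<sigma> \<omega>) w}"
  have "omega_partitions P le \<omega> n = (\<Union>w\<in>linear_extensions P le. ?A w)"
  proof (intro equalityI subsetI)
    fix \<sigma> assume \<sigma>: "\<sigma> \<in> omega_partitions P le \<omega> n"
    obtain w where w: "distinct w" "set w = P" "sorted_wrt (lex_less \<sigma> \<omega>) w"
      using lex_sorted_list_exists[OF P inj] by blast
    have "sorted_wrt (\<lambda>a b. \<not> le b a) w"
    proof (rule sorted_wrt_mono_rel[OF _ w(3)], rule notI)
      fix x y assume xy: "x \<in> set w" "y \<in> set w" "lex_less \<sigma> \<omega> x y" "le y x"
      then have "x \<noteq> y" by (auto simp: lex_less_def)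
      then have "lex_less \<sigma> \<omega> y x"
        using \<sigma> xy w(2) by (auto simp: omega_partitions_def pless_def)
      then show False using xy by (auto simp: lex_less_def)
    qed
    then show "\<sigma> \<in> (\<Union>w\<in>linear_extensions P le. ?A w)"
      using w \<sigma> by (auto simp: linear_extensions_sorted_wrt omega_partitions_def)
  next
    fix \<sigma> assume "\<sigma> \<in> (\<Union>w\<in>linear_extensions P le. ?A w)"
    then obtain w where w: "w \<in> linear_extensions P le" "\<sigma> \<in> ?A w" by blast
    have "lex_less \<sigma> \<omega> x y" if xy: "x \<in> P" "y \<in> P" "pless le x y" for x y
    proof -
      obtain i j where ij: "i < length w" "j < length w" "w ! i = x" "w ! j = y"
        using xy w(1) by (auto simp: linear_extensions_def in_set_conv_nth)
      then have "i \<le> j" "i \<noteq> j" using xy w(1) by (auto simp: linear_extensions_def pless_def)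
      then show ?thesis using w(2) ij sorted_wrt_nth_less[of _ w i j] by auto
    qed
    then show "\<sigma> \<in> omega_partitions P le \<omega> n" using w(2) by (auto simp: omega_partitions_def)
  qed
  moreover have "card (\<Union>w\<in>linear_extensions P le. ?A w) =
      (\<Sum>w\<in>linear_extensions P le. card (?A w))"
  proof (intro card_UN_disjoint ballI impI)
    show "finite (linear_extensions P le)" by (rule finite_linear_extensions[OF P])
    show "finite (?A w)" for w
      using P by (auto intro: finite_subset[of _ "P \<rightarrow>\<^sub>E {0..n}"] finite_PiE)
    fix w w' assume "w \<in> linear_extensions P le" "w' \<in> linear_extensions P le" "w \<noteq> w'"
    then show "?A w \<inter> ?A w' = {}"
      using lex_sorted_list_unique[of w w'] inj by (auto simp: linear_extensions_def)
  qed
  ultimately show ?thesis by simp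
qed

text \<open>For \<open>m \<ge> 0\<close> this is the binomial coefficient of \<open>m + p\<close>
  over \<open>p\<close>. The value 1 at \<open>m = 0\<close> and, for \<open>p > 0\<close>, the
  value 0 at negative \<open>m\<close> produce the unitriangular system solved below.\<close>

definition mono_count :: "nat \<Rightarrow> int \<Rightarrow> nat" where
  "mono_count p m = card {g \<in> {..<p} \<rightarrow>\<^sub>E {0..m}. \<forall>i. Suc i < p \<longrightarrow> g i \<le> g (Suc i)}"

lemma mono_count_0: "mono_count p 0 = 1"
proof -
  have "{g \<in> {..<p} \<rightarrow>\<^sub>E {0..0::int}. \<forall>i. Suc i < p \<longrightarrow> g i \<le> g (Suc i)} = {\<lambda>i\<in>{..<p}. 0}"
    by (auto simp: PiE_eq_singleton PiE_iff extensional_def fun_eq_iff)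
  then show ?thesis by (simp add: mono_count_def)
qed

lemma mono_count_neg: "0 < p \<Longrightarrow> m < 0 \<Longrightarrow> mono_count p m = 0"
  by (auto simp: mono_count_def PiE_eq_empty_iff)

lemma mono_below_SucI:
  fixes g :: "nat \<Rightarrow> int"
  assumes "\<And>i. Suc i < p \<Longrightarrow> g i \<le> g (Suc i)" "i \<le> j" "j < p"
  shows "g i \<le> g j"
  using assms(2,3)
proof (induction j rule: dec_induct)
  case (step k)
  then show ?case using assms(1)[of k] by simp
qed simp

text \<open>Subtracting from the value at each position the number of descents before it turns the
  partitions compatible with \<open>w\<close> into weakly increasing sequences.\<close>

lemma card_lex_sorted:
  assumes w: "distinct w" "set w = P" "w \<noteq> []" and inj: "inj_on \<omega> P"
  shows "card {\<sigma> \<in> P \<rightarrow>\<^sub>E {0..n}. sorted_wrt (lex_less \<sigma> \<omega>) w} =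
    mono_count (length w) (n - int (des (map \<omega> w)))"
proof -
  let ?p = "length w" and ?d = "int (des (map \<omega> w))"
  let ?desc = "\<lambda>j. \<omega> (w ! j) > \<omega> (w ! Suc j)"
  define D where "D i = int (card {j. j < i \<and> ?desc j})" for i
  have D0: "D 0 = 0" by (simp add: D_def)
  have DS: "D (Suc i) = D i + of_bool (?desc i)" for i
  proof -
    have "{j. j < Suc i \<and> ?desc j} = {j. j < i \<and> ?desc j} \<union> (if ?desc i then {i} else {})"
      by (auto simp: less_Suc_eq)
    then show ?thesis by (simp add: D_def)
  qed
  have Dd: "D (?p - 1) = ?d"
    unfolding D_def des_def by (intro arg_cong[where f = int] arg_cong[where f = card]) auto
  have Dmono: "D i \<le> D j" if "i \<le> j" for i j
    using that by (induction j rule: dec_induct) (auto simp: DS)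
  \<comment> \<open>By transitivity only adjacent positions matter. For integers a strict increase
    is an increase by at least one, and \<open>D\<close> grows by one exactly at the
    descents.\<close>
  have lex: "sorted_wrt (lex_less \<sigma> \<omega>) w \<longleftrightarrow>
      (\<forall>i. Suc i < ?p \<longrightarrow> \<sigma> (w ! i) - D i \<le> \<sigma> (w ! Suc i) - D (Suc i))" for \<sigma>
  proof -
    have "lex_less \<sigma> \<omega> (w ! i) (w ! Suc i) \<longleftrightarrow> \<sigma> (w ! i) - D i \<le> \<sigma> (w ! Suc i) - D (Suc i)"
      if "Suc i < ?p" for i
    proof -
      have "\<omega> (w ! i) \<noteq> \<omega> (w ! Suc i)"
        using inj that w unfolding inj_on_def
        by (metis Suc_lessD n_not_Suc_n nth_eq_iff_index_eq nth_mem)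
      then show ?thesis by (auto simp: lex_less_def DS)
    qed
    then show ?thesis by (auto simp: sorted_wrt_iff_nth_Suc_transp[OF transp_lex_less])
  qed
  define idx where "idx = inv_into {..<?p} ((!) w)"
  have bij: "bij_betw ((!) w) {..<?p} P" using w by (auto intro: bij_betw_nth)
  have idx: "idx x < ?p" "w ! idx x = x" if "x \<in> P" for x
    using bij that inv_into_into[of x "(!) w" "{..<?p}"] unfolding idx_def bij_betw_def
    by (auto simp: f_inv_into_f)
  have idx_nth: "idx (w ! i) = i" if "i < ?p" for i
    using bij that by (simp add: idx_def bij_betw_def)
  have nth_P: "w ! i \<in> P" if "i < ?p" for i using w that by auto
  let ?A = "{\<sigma> \<in> P \<rightarrow>\<^sub>E {0..n}. sorted_wrt (lex_less \<sigma> \<omega>) w}"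
  let ?B = "{g \<in> {..<?p} \<rightarrow>\<^sub>E {0..n - ?d}. \<forall>i. Suc i < ?p \<longrightarrow> g i \<le> g (Suc i)}"
  let ?F = "\<lambda>\<sigma>. \<lambda>i\<in>{..<?p}. \<sigma> (w ! i) - D i"
  let ?G = "\<lambda>g. \<lambda>x\<in>P. g (idx x) + D (idx x)"
  have "bij_betw ?F ?A ?B"
  proof (rule bij_betw_byWitness[where f' = ?G])
    show "\<forall>\<sigma>\<in>?A. ?G (?F \<sigma>) = \<sigma>" by (auto simp: fun_eq_iff idx PiE_iff extensional_def)
    show "\<forall>g\<in>?B. ?F (?G g) = g" by (auto simp: fun_eq_iff idx_nth nth_P PiE_iff extensional_def)
    show "?F ` ?A \<subseteq> ?B"
    proof clarify
      fix \<sigma> assume \<sigma>: "\<sigma> \<in> P \<rightarrow>\<^sub>E {0..n}" "sorted_wrt (lex_less \<sigma> \<omega>) w"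
      let ?g = "\<lambda>i. \<sigma> (w ! i) - D i"
      have step: "\<And>i. Suc i < ?p \<Longrightarrow> ?g i \<le> ?g (Suc i)" using \<sigma>(2) lex by blast
      \<comment> \<open>Monotonicity reduces the bounds to the two ends, where \<open>D\<close>
        equals 0 and \<open>?d\<close>.\<close>
      have "0 \<le> ?g i \<and> ?g i \<le> n - ?d" if "i < ?p" for i
      proof -
        have "?g 0 \<le> ?g i" "?g i \<le> ?g (?p - 1)"
          using mono_below_SucI[of ?p ?g, OF step] that by simp_all
        moreover have "0 \<le> \<sigma> (w ! 0)" "\<sigma> (w ! (?p - 1)) \<le> n"
          using \<sigma>(1) nth_P that by (force simp: PiE_iff)+
        ultimately show ?thesis using D0 Dd by simp
      qed
      then show "?F \<sigma> \<in> {..<?p} \<rightarrow>\<^sub>E {0..n - ?d} \<and> (\<forall>i. Suc i < ?p \<longrightarrow> ?F \<sigma> i \<le> ?F \<sigma> (Suc i))"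
        using step by auto
    qed
    show "?G ` ?B \<subseteq> ?A"
    proof clarify
      fix g assume g: "g \<in> {..<?p} \<rightarrow>\<^sub>E {0..n - ?d}" "\<forall>i. Suc i < ?p \<longrightarrow> g i \<le> g (Suc i)"
      have "0 \<le> g i + D i \<and> g i + D i \<le> n" if "i < ?p" for i
      proof -
        have "D 0 \<le> D i" "D i \<le> D (?p - 1)" using that by (auto intro: Dmono)
        moreover have "0 \<le> g i" "g i \<le> n - ?d" using g(1) that by (auto simp: PiE_iff)
        ultimately show ?thesis using D0 Dd by simp
      qed
      moreover have "sorted_wrt (lex_less (?G g) \<omega>) w"
        unfolding lex using g(2) by (simp add: nth_P idx_nth)
      ultimately show "?G g \<in> P \<rightarrow>\<^sub>E {0..n} \<and> sorted_wrt (lex_less (?G g) \<omega>) w"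
        using idx by auto
    qed
  qed
  then show ?thesis unfolding mono_count_def by (rule bij_betw_same_card)
qed

text \<open>With \<open>p = card P\<close>, the coefficient form of the identity that the generating
  function of these counts over \<open>n \<ge> 0\<close> is
  \<open>W / (1 - t)^(p + 1)\<close>.\<close>

lemma card_omega_partitions_des:
  assumes "finite P" "P \<noteq> {}" "inj_on \<omega> P"
  shows "card (omega_partitions P le \<omega> n) =
    (\<Sum>w\<in>linear_extensions P le. mono_count (card P) (n - int (des (map \<omega> w))))"
proof -
  have "card {\<sigma> \<in> P \<rightarrow>\<^sub>E {0..n}. sorted_wrt (lex_less \<sigma> \<omega>) w} =
      mono_count (card P) (n - int (des (map \<omega> w)))" if "w \<in> linear_extensions P le" for w
  proof -
    have w: "distinct w" "set w = P" "w \<noteq> []"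
      using that assms(2) by (auto simp: linear_extensions_def)
    have "card P = length w" using distinct_card[OF w(1)] w(2) by simp
    then show ?thesis using card_lex_sorted[OF w assms(3), of n] by (simp only:)
  qed
  then show ?thesis by (simp add: card_omega_partitions[OF assms(1,3)])
qed

text \<open>The counting functions \<open>n \<mapsto> h (n - k)\<close> are linearly independent, being unitriangular.\<close>

lemma unitriangular_count_unique:
  fixes f g :: "'b \<Rightarrow> int" and h :: "int \<Rightarrow> nat"
  assumes L: "finite L" and h: "h 0 = 1" "\<And>m. m < 0 \<Longrightarrow> h m = 0"
    and eq: "\<And>n. (\<Sum>w\<in>L. h (n - f w)) = (\<Sum>w\<in>L. h (n - g w))"
  shows "card {w \<in> L. f w = k} = card {w \<in> L. g w = k}"
proof -
  \<comment> \<open>A starting point for the induction on \<open>k\<close>; the exponents may be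
    negative, since a shift is subtracted from a descent number.\<close>
  obtain lo where lo: "\<And>w. w \<in> L \<Longrightarrow> lo \<le> f w \<and> lo \<le> g w"
  proof -
    let ?S = "insert 0 (f ` L \<union> g ` L)"
    have "Min ?S \<le> f w \<and> Min ?S \<le> g w" if "w \<in> L" for w
      using L that by (auto intro!: Min_le)
    then show ?thesis using that by blast
  qed
  \<comment> \<open>Exponents above \<open>n\<close> contribute nothing, those equal to
    \<open>n\<close> contribute 1 each, and the smaller ones are governed by counts already
    compared.\<close>
  have split: "(\<Sum>w\<in>L. h (n - e w)) = card {w \<in> L. e w = n} + (\<Sum>j\<in>{lo..<n}. card {w \<in> L. e w = j} * h (n - j))"
    if lo: "\<And>w. w \<in> L \<Longrightarrow> lo \<le> e w" and n: "lo \<le> n" for e n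
  proof -
    have "(\<Sum>w\<in>L. h (n - e w)) = (\<Sum>w | w \<in> L \<and> e w \<le> n. h (n - e w))"
      using L by (intro sum.mono_neutral_right) (auto intro!: h(2))
    also have "\<dots> = (\<Sum>j\<in>{lo..n}. \<Sum>w | w \<in> {w \<in> L. e w \<le> n} \<and> e w = j. h (n - e w))"
      using L lo by (intro sum.group[symmetric]) auto
    also have "\<dots> = (\<Sum>j\<in>{lo..n}. card {w \<in> L. e w = j} * h (n - j))"
    proof (rule sum.cong[OF refl])
      fix j assume "j \<in> {lo..n}"
      then have "{w. w \<in> {w \<in> L. e w \<le> n} \<and> e w = j} = {w \<in> L. e w = j}" by auto
      then show "(\<Sum>w | w \<in> {w \<in> L. e w \<le> n} \<and> e w = j. h (n - e w)) = card {w \<in> L. e w = j} * h (n - j)"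
        by simp
    qed
    also have "{lo..n} = insert n {lo..<n}" using n by auto
    finally show ?thesis using h(1) by simp
  qed
  have "card {w \<in> L. f w = k} = card {w \<in> L. g w = k}" if "lo \<le> k" for k
    using that
  proof (induction k rule: measure_induct_rule[of "\<lambda>k. nat (k - lo)"])
    case (less k)
    have "(\<Sum>j\<in>{lo..<k}. card {w \<in> L. f w = j} * h (k - j)) =
          (\<Sum>j\<in>{lo..<k}. card {w \<in> L. g w = j} * h (k - j))"
      using less.IH by (intro sum.cong refl) auto
    moreover have "(\<Sum>w\<in>L. h (k - f w)) = card {w \<in> L. f w = k} +
        (\<Sum>j\<in>{lo..<k}. card {w \<in> L. f w = j} * h (k - j))"
      using lo less.prems by (intro split) auto
    moreover have "(\<Sum>w\<in>L. h (k - g w)) = card {w \<in> L. g w = k} +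
        (\<Sum>j\<in>{lo..<k}. card {w \<in> L. g w = j} * h (k - j))"
      using lo less.prems by (intro split) auto
    ultimately show ?case using eq[of k] by linarith
  qed
  moreover have "card {w \<in> L. f w = k} = card {w \<in> L. g w = k}" if "k < lo"
  proof -
    have "{w \<in> L. f w = k} = {}" "{w \<in> L. g w = k} = {}" using lo that by force+
    then show ?thesis by (simp only:)
  qed
  ultimately show ?thesis by (cases "lo \<le> k") auto
qed

section \<open>Consistent labelings and rank shifts\<close>

lemma pless_trans:
  "partial_order_on' P le \<Longrightarrow> x \<in> P \<Longrightarrow> y \<in> P \<Longrightarrow> z \<in> P \<Longrightarrow>
    pless le x y \<Longrightarrow> pless le y z \<Longrightarrow> pless le x z"
  unfolding partial_order_on'_def pless_def by blast

lemma pless_imp_tranclp_covers: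
  assumes P: "finite P" "partial_order_on' P le" and "x \<in> P" "y \<in> P" "pless le x y"
  shows "(covers P le)\<^sup>+\<^sup>+ x y"
  using assms(3-)
proof (induction "card {z \<in> P. pless le x z \<and> pless le z y}" arbitrary: x y rule: less_induct)
  case less
  show ?case
  proof (cases "covers P le x y")
    case False
    then obtain z where z: "z \<in> P" "pless le x z" "pless le z y"
      using less.prems by (auto simp: covers_def)
    have "\<not> pless le z z" by (simp add: pless_def)
    then have "{w \<in> P. pless le x w \<and> pless le w z} \<subset> {w \<in> P. pless le x w \<and> pless le w y}"
      "{w \<in> P. pless le z w \<and> pless le w y} \<subset> {w \<in> P. pless le x w \<and> pless le w y}"
      using z less.prems pless_trans[OF P(2), of _ z y] pless_trans[OF P(2), of x z] by blast+
    then have "(covers P le)\<^sup>+\<^sup>+ x z" "(covers P le)\<^sup>+\<^sup>+ z y"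
      using z less.prems P(1) by (auto intro!: less.hyps psubset_card_mono)
    then show ?thesis by (rule tranclp_trans)
  qed auto
qed

lemma covers_induct_pless:
  assumes P: "finite P" "partial_order_on' P le" and xy: "x \<in> P" "y \<in> P" "pless le x y"
    and R: "transp R" "\<And>x y. covers P le x y \<Longrightarrow> R x y"
  shows "R x y"
  using pless_imp_tranclp_covers[OF P xy]
proof (induction rule: tranclp_induct)
  case (base y)
  then show ?case by (rule R(2))
next
  case (step y z)
  then show ?case using transpD[OF R(1)] R(2) by blast
qed

lemma minimal_below:
  assumes P: "finite P" "partial_order_on' P le" and "x \<in> P"
  shows "\<exists>m\<in>P. (\<forall>w\<in>P. \<not> pless le w m) \<and> (m = x \<or> pless le m x)"
  using assms(3)
proof (induction "card {z \<in> P. pless le z x}" arbitrary: x rule: less_induct)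
  case less
  show ?case
  proof (cases "\<forall>w\<in>P. \<not> pless le w x")
    case False
    then obtain y where y: "y \<in> P" "pless le y x" by blast
    have "\<not> pless le y y" by (simp add: pless_def)
    then have "{z \<in> P. pless le z y} \<subset> {z \<in> P. pless le z x}"
      using y less.prems pless_trans[OF P(2), of _ y x] by blast
    then have "card {z \<in> P. pless le z y} < card {z \<in> P. pless le z x}"
      using P(1) by (auto intro!: psubset_card_mono)
    from less.hyps[OF this y(1)] obtain m where
      "m \<in> P" "\<forall>w\<in>P. \<not> pless le w m" "m = y \<or> pless le m y" by blast
    then show ?thesis using y less.prems pless_trans[OF P(2), of m y x] by blast
  qed (use less.prems in auto)
qed

lemma maximal_above:
  assumes P: "finite P" "partial_order_on' P le" and "x \<in> P"
  shows "\<exists>m. maximal_elem P le m \<and> (m = x \<or> pless le x m)"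
proof -
  have dual: "pless (\<lambda>x y. le y x) a b \<longleftrightarrow> pless le b a" for a b by (auto simp: pless_def)
  have "partial_order_on' P (\<lambda>x y. le y x)" using P(2) unfolding partial_order_on'_def by blast
  from minimal_below[OF P(1) this assms(3)] show ?thesis
    unfolding dual maximal_elem_def by blast
qed

lemma max_chains_ideal_snoc:
  assumes "c \<in> max_chains_ideal P le x" "covers P le x y"
  shows "c @ [y] \<in> max_chains_ideal P le y"
    and "chain_eps_sum \<omega> (c @ [y]) = chain_eps_sum \<omega> c + eps \<omega> x y"
proof -
  have c: "c \<noteq> []" "c ! (length c - 1) = x" using assms(1)
    by (auto simp: max_chains_ideal_def last_conv_nth)
  have "covers P le ((c @ [y]) ! i) ((c @ [y]) ! Suc i)" if "Suc i < length (c @ [y])" for i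
  proof (cases "Suc i < length c")
    case True
    then show ?thesis using assms(1) by (auto simp: max_chains_ideal_def nth_append)
  next
    case False
    then have "i = length c - 1" "Suc i = length c" using that c by auto
    then show ?thesis using assms(2) c by (simp add: nth_append)
  qed
  then show "c @ [y] \<in> max_chains_ideal P le y"
    using assms(1) by (auto simp: max_chains_ideal_def)
  obtain n where n: "length c = Suc n" using c by (cases c) auto
  have "(\<Sum>i<n. eps \<omega> ((c @ [y]) ! i) ((c @ [y]) ! Suc i)) = (\<Sum>i<n. eps \<omega> (c ! i) (c ! Suc i))"
    using n by (intro sum.cong refl) (simp add: nth_append)
  then show "chain_eps_sum \<omega> (c @ [y]) = chain_eps_sum \<omega> c + eps \<omega> x y"
    using n c by (simp add: chain_eps_sum_def nth_append)
qed

text \<open>Consistency determines \<open>\<rho>\<close> only through chains, so it yields a value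
  only where a maximal chain exists.\<close>

lemma max_chains_ideal_nonempty:
  assumes P: "finite P" "partial_order_on' P le" and x: "x \<in> P"
  shows "max_chains_ideal P le x \<noteq> {}"
proof -
  have min: "[m] \<in> max_chains_ideal P le m" if "m \<in> P" "\<forall>w\<in>P. \<not> pless le w m" for m
    using that by (auto simp: max_chains_ideal_def)
  obtain m where m: "m \<in> P" "\<forall>w\<in>P. \<not> pless le w m" "m = x \<or> pless le m x"
    using minimal_below[OF P x] by blast
  show ?thesis
  proof (cases "m = x")
    case False
    then have "(covers P le)\<^sup>+\<^sup>+ m x" using pless_imp_tranclp_covers[OF P m(1) x] m by blast
    then show ?thesis
    proof (induction rule: tranclp_induct)
      case (base y)
      show ?case using max_chains_ideal_snoc(1)[OF min[OF m(1,2)] base] by blast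
    next
      case (step y z)
      then obtain c where "c \<in> max_chains_ideal P le y" by blast
      from max_chains_ideal_snoc(1)[OF this step.hyps(2)] show ?case by blast
    qed
  qed (use min m in auto)
qed

text \<open>Extending a maximal chain that ends in \<open>x\<close> by \<open>y\<close> turns the
  condition on whole chains into a local one.\<close>

lemma omega_consistent_rank_covers:
  assumes "finite P" "partial_order_on' P le" "omega_consistent_rank P le \<omega> \<rho>" "covers P le x y"
  shows "\<rho> y - \<rho> x = eps \<omega> x y"
proof -
  have xy: "x \<in> P" "y \<in> P" using assms(4) by (auto simp: covers_def)
  obtain c where c: "c \<in> max_chains_ideal P le x"
    using max_chains_ideal_nonempty[OF assms(1,2) xy(1)] by blast
  note s = max_chains_ideal_snoc[OF c assms(4)]
  show ?thesis using s(2)[of \<omega>] s(1) c xy assms(3) by (auto simp: omega_consistent_rank_def)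
qed

lemma omega_consistent_rank_minimal:
  assumes "omega_consistent_rank P le \<omega> \<rho>" "m \<in> P" "\<forall>w\<in>P. \<not> pless le w m"
  shows "\<rho> m = 0"
proof -
  have "[m] \<in> max_chains_ideal P le m" using assms by (auto simp: max_chains_ideal_def)
  then show ?thesis using assms by (force simp: omega_consistent_rank_def chain_eps_sum_def)
qed

text \<open>In terms of \<open>2 \<sigma> + \<rho>\<close> the weak and the strict inequalities required on covering pairs take
  the same form, because \<open>\<rho>\<close> changes by one in the direction of the sign.\<close>

lemma omega_partition_condition_iff:
  assumes P: "finite P" "partial_order_on' P le"
    and rank: "\<And>x y. covers P le x y \<Longrightarrow> \<rho> y - \<rho> x = eps \<omega> x y"
    and inj: "inj_on \<omega> P"
  shows "(\<forall>x\<in>P. \<forall>y\<in>P. pless le x y \<longrightarrow> lex_less \<sigma> \<omega> x y) \<longleftrightarrow>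
         (\<forall>x y. covers P le x y \<longrightarrow> 2 * \<sigma> x + \<rho> x < 2 * \<sigma> y + \<rho> y)"
proof -
  have *: "lex_less \<sigma> \<omega> x y \<longleftrightarrow> 2 * \<sigma> x + \<rho> x < 2 * \<sigma> y + \<rho> y" if "covers P le x y" for x y
  proof -
    have "\<omega> x \<noteq> \<omega> y" using that inj by (auto simp: covers_def pless_def inj_on_def)
    then show ?thesis using rank[OF that] by (auto simp: lex_less_def eps_def split: if_splits)
  qed
  show ?thesis
  proof (intro iffI allI impI ballI)
    fix x y
    assume "\<forall>x\<in>P. \<forall>y\<in>P. pless le x y \<longrightarrow> lex_less \<sigma> \<omega> x y" "covers P le x y"
    then show "2 * \<sigma> x + \<rho> x < 2 * \<sigma> y + \<rho> y" using *[of x y] by (auto simp: covers_def)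
  next
    fix x y
    assume "\<forall>x y. covers P le x y \<longrightarrow> 2 * \<sigma> x + \<rho> x < 2 * \<sigma> y + \<rho> y" "x \<in> P" "y \<in> P" "pless le x y"
    then show "lex_less \<sigma> \<omega> x y"
      using covers_induct_pless[OF P _ _ _ transp_lex_less] * by blast
  qed
qed

text \<open>Since \<open>2 \<sigma> + \<rho> = 2 (\<sigma> + q) + \<rho>'\<close>, the conditions on
  covers coincide. The shifted map is again weakly increasing, so its range need only be checked at
  minimal elements, where \<open>q = 0\<close>, and at maximal ones, where
  \<open>q = s\<close>.\<close>

lemma omega_partitions_shift_into:
  assumes P: "finite P" "partial_order_on' P le"
    and rank: "\<And>x y. covers P le x y \<Longrightarrow> \<rho> y - \<rho> x = eps \<omega> x y" "inj_on \<omega> P"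
    and rank': "\<And>x y. covers P le x y \<Longrightarrow> \<rho>' y - \<rho>' x = eps \<omega>' x y" "inj_on \<omega>' P"
    and q: "\<And>x. x \<in> P \<Longrightarrow> \<rho> x = \<rho>' x + 2 * q x"
    and min: "\<And>m. m \<in> P \<Longrightarrow> \<forall>w\<in>P. \<not> pless le w m \<Longrightarrow> q m = 0"
    and max: "\<And>m. maximal_elem P le m \<Longrightarrow> q m = s"
    and \<sigma>: "\<sigma> \<in> omega_partitions P le \<omega> n"
  shows "(\<lambda>x\<in>P. \<sigma> x + q x) \<in> omega_partitions P le \<omega>' (n + s)"
proof -
  let ?\<tau> = "\<lambda>x\<in>P. \<sigma> x + q x"
  have "\<forall>x y. covers P le x y \<longrightarrow> 2 * \<sigma> x + \<rho> x < 2 * \<sigma> y + \<rho> y"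
    using \<sigma> omega_partition_condition_iff[OF P rank] by (auto simp: omega_partitions_def)
  then have "\<forall>x y. covers P le x y \<longrightarrow> 2 * ?\<tau> x + \<rho>' x < 2 * ?\<tau> y + \<rho>' y"
    using q by (auto simp: covers_def algebra_simps)
  then have lex: "\<forall>x\<in>P. \<forall>y\<in>P. pless le x y \<longrightarrow> lex_less ?\<tau> \<omega>' x y"
    using omega_partition_condition_iff[OF P rank'] by blast
  have mono: "?\<tau> x \<le> ?\<tau> y" if "x \<in> P" "y \<in> P" "x = y \<or> pless le x y" for x y
    using lex that by (force simp: lex_less_def simp del: restrict_apply)
  have "?\<tau> x \<in> {0..n + s}" if x: "x \<in> P" for x
  proof -
    obtain a where a: "a \<in> P" "\<forall>w\<in>P. \<not> pless le w a" "a = x \<or> pless le a x"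
      using minimal_below[OF P x] by blast
    obtain b where b: "maximal_elem P le b" "x = b \<or> pless le x b"
      using maximal_above[OF P x] by blast
    have "b \<in> P" using b by (simp add: maximal_elem_def)
    have "?\<tau> a \<le> ?\<tau> x" "?\<tau> x \<le> ?\<tau> b" using mono a b \<open>b \<in> P\<close> x by blast+
    moreover have "0 \<le> ?\<tau> a" "?\<tau> b \<le> n + s"
      using \<sigma> a b \<open>b \<in> P\<close> min max by (auto simp: omega_partitions_def PiE_iff)
    ultimately show ?thesis by simp
  qed
  then show ?thesis using lex unfolding omega_partitions_def by (simp add: PiE_iff)
qed

lemma card_omega_partitions_shift:
  assumes P: "finite P" "partial_order_on' P le"
    and rank: "\<And>x y. covers P le x y \<Longrightarrow> \<rho> y - \<rho> x = eps \<omega> x y" "inj_on \<omega> P"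
    and rank': "\<And>x y. covers P le x y \<Longrightarrow> \<rho>' y - \<rho>' x = eps \<omega>' x y" "inj_on \<omega>' P"
    and q: "\<And>x. x \<in> P \<Longrightarrow> \<rho> x = \<rho>' x + 2 * q x"
    and min: "\<And>m. m \<in> P \<Longrightarrow> \<forall>w\<in>P. \<not> pless le w m \<Longrightarrow> q m = 0"
    and max: "\<And>m. maximal_elem P le m \<Longrightarrow> q m = s"
  shows "card (omega_partitions P le \<omega> n) = card (omega_partitions P le \<omega>' (n + s))"
proof (rule bij_betw_same_card)
  let ?F = "\<lambda>\<sigma>. \<lambda>x\<in>P. \<sigma> x + q x" and ?G = "\<lambda>\<sigma>. \<lambda>x\<in>P. \<sigma> x + - q x"
  show "bij_betw ?F (omega_partitions P le \<omega> n) (omega_partitions P le \<omega>' (n + s))"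
  proof (rule bij_betw_byWitness[where f' = ?G])
    show "\<forall>\<sigma>\<in>omega_partitions P le \<omega> n. ?G (?F \<sigma>) = \<sigma>"
      "\<forall>\<sigma>\<in>omega_partitions P le \<omega>' (n + s). ?F (?G \<sigma>) = \<sigma>"
      by (auto simp: omega_partitions_def fun_eq_iff PiE_iff extensional_def)
    show "?F ` omega_partitions P le \<omega> n \<subseteq> omega_partitions P le \<omega>' (n + s)"
      using omega_partitions_shift_into[OF P rank rank' q min max] by blast
    \<comment> \<open>The inverse is the same construction with the labelings exchanged and
      \<open>q\<close>, \<open>s\<close> negated.\<close>
    have "?G \<sigma> \<in> omega_partitions P le \<omega> (n + s + - s)"
      if "\<sigma> \<in> omega_partitions P le \<omega>' (n + s)" for \<sigma>
      by (rule omega_partitions_shift_into[OF P rank' rank _ _ _ that]) (auto simp: q min max)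
    then show "?G ` omega_partitions P le \<omega>' (n + s) \<subseteq> omega_partitions P le \<omega> n" by auto
  qed
qed

section \<open>Transfer of descent polynomials between labelings\<close>

lemma coeff_W:
  "finite P \<Longrightarrow> coeff (W P le \<omega>) j = card {w \<in> linear_extensions P le. des (map \<omega> w) = j}"
  by (simp add: W_def coeff_sum finite_linear_extensions sum.If_cases Int_def)

text \<open>Equal counts for every bound \<open>n\<close> force equal exponent distributions, so the
  polynomial of \<open>\<omega>\<close> is \<open>t^(-s)\<close> times that of
  \<open>\<omega>'\<close>. The coefficient form allows \<open>s\<close> of either sign.\<close>

lemma coeff_W_shift:
  assumes P: "finite P" "P \<noteq> {}" "partial_order_on' P le"
    and rank: "\<And>x y. covers P le x y \<Longrightarrow> \<rho> y - \<rho> x = eps \<omega> x y" "inj_on \<omega> P"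
    and rank': "\<And>x y. covers P le x y \<Longrightarrow> \<rho>' y - \<rho>' x = eps \<omega>' x y" "inj_on \<omega>' P"
    and q: "\<And>x. x \<in> P \<Longrightarrow> \<rho> x = \<rho>' x + 2 * q x"
    and min: "\<And>m. m \<in> P \<Longrightarrow> \<forall>w\<in>P. \<not> pless le w m \<Longrightarrow> q m = 0"
    and max: "\<And>m. maximal_elem P le m \<Longrightarrow> q m = s"
  shows "coeff (W P le \<omega>) j =
    (if 0 \<le> int j + s then coeff (W P le \<omega>') (nat (int j + s)) else 0)"
proof -
  let ?L = "linear_extensions P le"
  have "(\<Sum>w\<in>?L. mono_count (card P) (n - int (des (map \<omega> w)))) =
      (\<Sum>w\<in>?L. mono_count (card P) (n - (int (des (map \<omega>' w)) - s)))" for n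
  proof -
    have shift: "n - (k - s) = n + s - k" for k by simp
    show ?thesis
      unfolding shift card_omega_partitions_des[OF P(1,2) rank(2), symmetric]
        card_omega_partitions_des[OF P(1,2) rank'(2), symmetric]
      by (rule card_omega_partitions_shift[OF P(1,3) rank rank' q min max])
  qed
  then have "card {w \<in> ?L. int (des (map \<omega> w)) = int j} =
      card {w \<in> ?L. int (des (map \<omega>' w)) - s = int j}"
    using P by (intro unitriangular_count_unique[where h = "mono_count (card P)"])
      (auto simp: finite_linear_extensions mono_count_0 mono_count_neg card_gt_0_iff)
  moreover have "{w \<in> ?L. int (des (map \<omega>' w)) - s = int j} =
      (if 0 \<le> int j + s then {w \<in> ?L. des (map \<omega>' w) = nat (int j + s)} else {})"
    by auto
  ultimately show ?thesis using P by (simp add: coeff_W)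
qed

section \<open>Unimodality\<close>

lemma linear_extensions_hd_minimal:
  assumes "w \<in> linear_extensions P le" "P \<noteq> {}"
  shows "hd w \<in> P" "\<forall>z\<in>P. \<not> pless le z (hd w)"
proof -
  have w: "set w = P" "sorted_wrt (\<lambda>a b. \<not> le b a) w" "w \<noteq> []"
    using assms by (auto simp: linear_extensions_sorted_wrt)
  then obtain x xs where "w = x # xs" by (cases w) auto
  then show "hd w \<in> P" "\<forall>z\<in>P. \<not> pless le z (hd w)" using w by (auto simp: pless_def)
qed

text \<open>Covers change color, so the first cover on a chain between comparable elements of equal
  color supplies a separating element, and linear extensions are closed under rearrangement within
  blocks. They all start with color \<open>s\<close>; sorting them by the last color gives two
  gamma-positive sums with adjacent parameters.\<close>

lemma W_two_colored_unimodal: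
  assumes P: "finite P" "P \<noteq> {}" "partial_order_on' P le"
    and cov: "\<And>x y. covers P le x y \<Longrightarrow> c x \<noteq> c y"
    and min: "\<And>m. m \<in> P \<Longrightarrow> \<forall>w\<in>P. \<not> pless le w m \<Longrightarrow> c m = s"
    and inj: "inj_on f P"
    and mono: "\<And>x y. x \<in> P \<Longrightarrow> y \<in> P \<Longrightarrow> \<not> c x \<Longrightarrow> c y \<Longrightarrow> f x < f y"
  shows "\<exists>m. (\<forall>j<m. coeff (W P le f) j \<le> coeff (W P le f) (Suc j)) \<and>
             (\<forall>j\<ge>m. coeff (W P le f) (Suc j) \<le> coeff (W P le f) j)"
proof -
  let ?L = "linear_extensions P le"
  let ?S = "\<lambda>e. \<Sum>w | w \<in> ?L \<and> c (last w) = e. monom (1::nat) (des (map f w))"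
  have fin: "finite ?L" using finite_linear_extensions P by blast
  have sep: "\<exists>z\<in>P. c z \<noteq> c x \<and> le x z \<and> le z y"
    if xy: "x \<in> P" "y \<in> P" "pless le x y" "c x = c y" for x y
  proof -
    have "(covers P le)\<^sup>+\<^sup>+ x y" using pless_imp_tranclp_covers[OF P(1,3) xy(1-3)] .
    then obtain z where z: "covers P le x z" "(covers P le)\<^sup>*\<^sup>* z y" by (meson tranclpD)
    then have "z \<noteq> y" using cov xy(4) by blast
    then have "(covers P le)\<^sup>+\<^sup>+ z y" using z(2) by (metis rtranclpD)
    then have "z \<in> P \<and> y \<in> P \<and> le z y"
    proof (induction rule: tranclp_induct)
      case (step u v)
      then show ?case using P(3) unfolding covers_def pless_def partial_order_on'_def by blast
    qed (auto simp: covers_def pless_def)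
    then show ?thesis using cov[OF z(1)] z(1) by (auto simp: covers_def pless_def)
  qed
  have L: "w \<noteq> [] \<and> distinct w \<and> length w = card P \<and> c (hd w) = s \<and> set w = P" if "w \<in> ?L" for w
    using linear_extensions_hd_minimal[OF that P(2)] min that P(2)
    by (auto simp: linear_extensions_def distinct_card)
  have gamma: "gamma_pos d (?S e)" if "Suc d + of_bool e = card P + of_bool s" for d e
    using gamma_pos_color_closed[OF fin L linear_extensions_block_closed[OF sep] inj mono that] .
  have W: "W P le f = ?S True + ?S False"
  proof -
    have "?L = {w \<in> ?L. c (last w) = True} \<union> {w \<in> ?L. c (last w) = False}" by auto
    then show ?thesis unfolding W_def
      by (subst sum.union_disjoint[symmetric]) (use fin in \<open>auto intro!: sum.cong\<close>)
  qed
  have "0 < card P" using P by (simp add: card_gt_0_iff)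
  show ?thesis
  \<comment> \<open>In this case the parameter for last color \<open>True\<close> would be negative.
    The corresponding sum is empty, because a single letter of color \<open>False\<close> is both
    first and last.\<close>
  proof (cases "card P + of_bool s = 1")
    case True
    then have 1: "card P = 1" "\<not> s" using \<open>0 < card P\<close> by auto
    have "last w = hd w" if "w \<in> ?L" for w
      using L[OF that] 1 by (cases w) auto
    then have "?S True = 0" using L 1 by (intro sum.neutral) auto
    then have "W P le f = ?S False + 0" using W by simp
    then show ?thesis
      using gamma_pos_add_unimodal[OF gamma[of 0 False] gamma_pos.zero] True by simp
  next
    case False
    then obtain d where "card P + of_bool s = Suc (Suc d)"
      using \<open>0 < card P\<close> by (metis One_nat_def Suc_pred add_gr_0 not0_implies_Suc)
    then show ?thesis
      unfolding W using gamma_pos_add_unimodal[OF gamma[of d True] gamma[of "Suc d" False]] by simp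
  qed
qed

theorem theorem4p5:
  fixes P :: "'a set" and le :: "'a \<Rightarrow> 'a \<Rightarrow> bool"
    and \<omega> :: "'a \<Rightarrow> nat" and \<rho> :: "'a \<Rightarrow> int"
  assumes "finite P"
    and "partial_order_on' P le"
    and "labeling P \<omega>"
    and "omega_consistent_rank P le \<omega> \<rho>"
    and "\<forall>x y. maximal_elem P le x \<and> maximal_elem P le y \<longrightarrow> \<bar>\<rho> x - \<rho> y\<bar> \<le> 1"
  shows "unimodal_seq (coeff (W P le \<omega>))"
proof (cases "P = {}")
  case True
  then have "linear_extensions P le = {[]}" by (auto simp: linear_extensions_def)
  then have "W P le \<omega> = 1" by (simp add: W_def monom_0 one_pCons)
  then show ?thesis by (intro unimodal_seqI[of 0]) auto
next
  case False
  note P = assms(1) False assms(2)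
  have \<omega>: "inj_on \<omega> P" "\<And>x. x \<in> P \<Longrightarrow> \<omega> x \<le> card P"
    using assms(3) by (auto simp: labeling_def bij_betw_def)
  have rank: "\<rho> y - \<rho> x = eps \<omega> x y" if "covers P le x y" for x y
    using omega_consistent_rank_covers[OF assms(1,2,4) that] .
  \<comment> \<open>The ranks of maximal elements are \<open>r\<close> or \<open>r + 1\<close>,
    where \<open>r\<close> is the least of them. Taking \<open>b\<close> as the parity of
    \<open>r\<close> makes \<open>r + b\<close> even, so both values have the same integer half
    \<open>s\<close>.\<close>
  obtain b s :: int where b: "b \<in> {0, 1}"
    and s: "\<And>m. maximal_elem P le m \<Longrightarrow> (\<rho> m + b) div 2 = s"
  proof -
    let ?R = "\<rho> ` {m. maximal_elem P le m}"
    have fin: "finite ?R" using assms(1) by (auto simp: maximal_elem_def)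
    obtain x where "x \<in> P" using False by blast
    then have "?R \<noteq> {}" using maximal_above[OF assms(1,2)] by blast
    then have "Min ?R \<in> ?R" using fin by simp
    then obtain m0 where m0: "maximal_elem P le m0" "\<rho> m0 = Min ?R" by auto
    have "(\<rho> m + \<rho> m0 mod 2) div 2 = (\<rho> m0 + \<rho> m0 mod 2) div 2" if "maximal_elem P le m" for m
    proof -
      have "\<rho> m0 \<le> \<rho> m" using m0 fin that by auto
      then have "\<rho> m = \<rho> m0 \<or> \<rho> m = \<rho> m0 + 1" using assms(5) m0(1) that by force
      then show ?thesis by presburger
    qed
    then show ?thesis by (intro that[of "\<rho> m0 mod 2"]) auto
  qed
  \<comment> \<open>Halving \<open>\<rho> + b\<close> leaves a remainder in \<open>{0, 1}\<close>,
    so \<open>\<rho>'\<close> has values in \<open>{-b, 1 - b}\<close>, and the color records the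
    larger one. Adding \<open>Suc (card P)\<close> to the labels of that color puts them above all
    others and keeps the order within each color; \<open>\<omega>'\<close> is injective but need not
    have range \<open>{1..card P}\<close>.\<close>
  define q where "q x = (\<rho> x + b) div 2" for x
  define \<rho>' where "\<rho>' x = (\<rho> x + b) mod 2 - b" for x
  define c where "c x \<longleftrightarrow> odd (\<rho> x + b)" for x
  define \<omega>' where "\<omega>' x = \<omega> x + (if c x then Suc (card P) else 0)" for x
  have cov: "c x \<noteq> c y" if "covers P le x y" for x y
    using rank[OF that] by (auto simp: c_def eps_def split: if_splits) presburger+
  have mono: "\<omega>' x < \<omega>' y" if "x \<in> P" "y \<in> P" "\<not> c x" "c y" for x y
    using \<omega>(2)[OF that(1)] that by (simp add: \<omega>'_def)
  have inj: "inj_on \<omega>' P"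
  proof (rule inj_onI)
    fix x y assume xy: "x \<in> P" "y \<in> P" "\<omega>' x = \<omega>' y"
    then have "c x = c y" using mono[of x y] mono[of y x] by auto
    then show "x = y" using xy \<omega>(1) by (auto simp: \<omega>'_def inj_on_def)
  qed
  have \<rho>'_c: "\<rho>' x = of_bool (c x) - b" for x by (simp add: \<rho>'_def c_def mod2_eq_if)
  have rank': "\<rho>' y - \<rho>' x = eps \<omega>' x y" if "covers P le x y" for x y
  proof -
    have "x \<in> P" "y \<in> P" using that by (auto simp: covers_def)
    then show ?thesis using cov[OF that] mono[of x y] mono[of y x] by (auto simp: eps_def \<rho>'_c)
  qed
  have q: "\<rho> x = \<rho>' x + 2 * q x" for x unfolding \<rho>'_def q_def by presburger
  have min: "\<rho> m = 0" if "m \<in> P" "\<forall>w\<in>P. \<not> pless le w m" for m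
    using omega_consistent_rank_minimal[OF assms(4) that] .
  \<comment> \<open>Minimal elements have rank 0, and \<open>b div 2 = 0\<close> for both choices of
    \<open>b\<close>.\<close>
  have min_q: "q m = 0" if "m \<in> P" "\<forall>w\<in>P. \<not> pless le w m" for m
    using min[OF that] b by (auto simp: q_def)
  have min_c: "c m = odd b" if "m \<in> P" "\<forall>w\<in>P. \<not> pless le w m" for m
    using min[OF that] by (simp add: c_def)
  have max: "q m = s" if "maximal_elem P le m" for m using s[OF that] by (simp add: q_def)
  note shift = coeff_W_shift[where q = q and s = s and \<rho> = \<rho> and \<rho>' = \<rho>', OF P rank \<omega>(1) rank' inj q min_q max]
  obtain m where m: "\<And>j. j < m \<Longrightarrow> coeff (W P le \<omega>') j \<le> coeff (W P le \<omega>') (Suc j)"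
    "\<And>j. m \<le> j \<Longrightarrow> coeff (W P le \<omega>') (Suc j) \<le> coeff (W P le \<omega>') j"
    using W_two_colored_unimodal[where c = c and s = "odd b", OF P cov min_c inj mono] by blast
  show ?thesis
  \<comment> \<open>The turning index moves by \<open>s\<close> and is cut off at 0. Indices with
    \<open>j + s < 0\<close> carry coefficient 0 and lie on the rising side.\<close>
  proof (rule unimodal_seqI[of "nat (int m - s)"])
    fix j assume j: "j < nat (int m - s)"
    show "coeff (W P le \<omega>) j \<le> coeff (W P le \<omega>) (Suc j)"
    proof (cases "0 \<le> int j + s")
      case True
      then have "nat (int (Suc j) + s) = Suc (nat (int j + s))" "nat (int j + s) < m" using j by auto
      then show ?thesis using m(1)[of "nat (int j + s)"] True by (simp add: shift)
    qed (simp add: shift)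
  next
    fix j assume j: "nat (int m - s) \<le> j"
    then have "nat (int (Suc j) + s) = Suc (nat (int j + s))" "m \<le> nat (int j + s)" "0 \<le> int j + s" by auto
    then show "coeff (W P le \<omega>) (Suc j) \<le> coeff (W P le \<omega>) j"
      using m(2)[of "nat (int j + s)"] by (simp add: shift)
  qed
qed

end
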